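(* Let $(G,\{X_{ij}\})$ be an $A_2$-system, and for $\{i,j,k\}=\{1,2,3\}$ let $G_{ij}=\langle X_{ik},X_{kj}\rangle$. Then $$\kappa\Big(G,\bigcup_{i\ne j}G_{ij}\Big)\ge\frac38\qquad\text{and}\qquad \kappa\Big(G,\bigcup_{i\ne j}X_{ij}\Big)\ge\frac18.$$
   Context: $A_2$-system: a group $G$ generated by a collection of six subgroups $\{X_{ij}: 1\le i,j\le 3,\ i\ne j\}$ such that for every permutation $i,j,k$ of $\{1,2,3\}$: (a) $X_{ij}$ is abelian; (b) $X_{ij}$ and $X_{ik}$ commute elementwise; (c) $X_{ji}$ and $X_{ki}$ commute elementwise; (d) $[X_{ij},X_{jk}]=X_{ik}$, where $[A,B]$ denotes the subgroup generated by the commutators $[a,b]$, $a\in A$, $b\in B$. Kazhdan constant: for a group $G$ and $S\subseteq G$, $\kappa(G,S)$ is the infimum, over all unitary representations $V$ of $G$ (on complex Hilbert spaces) without nonzero $G$-invariant vectors, of $\inf\{\varepsilon>0: \exists\,0\ne v\in V,\ \|sv-v\|\le\varepsilon\|v\|\ \forall s\in S\}$. *)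

theory Defs
  imports "HOL-Algebra.Generated_Groups" "HOL-Analysis.Analysis"
begin

section \<open>Complex Hilbert spaces\<close>

text \<open>
  The library only has real inner product spaces. A complex Hilbert space is a complete real
  inner product space with a compatible complex scalar multiplication and a Hermitian form
  (linear in the first argument) whose real part is the real inner product. Positive
  definiteness of the Hermitian form is inherited from \<open>inner\<close>; the norm and
  the topology are those of the class \<open>real_inner\<close>.
\<close>

class chilbert_space = real_inner + complete_space +
  fixes scaleC :: "complex \<Rightarrow> 'a \<Rightarrow> 'a"  (infixr "*\<^sub>C" 75)
    and cinner :: "'a \<Rightarrow> 'a \<Rightarrow> complex"
  assumes scaleC_add_right: "c *\<^sub>C (x + y) = c *\<^sub>C x + c *\<^sub>C y"
    and scaleC_add_left: "(c + d) *\<^sub>C x = c *\<^sub>C x + d *\<^sub>C x"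
    and scaleC_scaleC: "c *\<^sub>C (d *\<^sub>C x) = (c * d) *\<^sub>C x"
    and scaleC_of_real: "complex_of_real r *\<^sub>C x = r *\<^sub>R x"
    and cinner_commute: "cinner x y = cnj (cinner y x)"
    and cinner_add_left: "cinner (x + y) z = cinner x z + cinner y z"
    and cinner_scaleC_left: "cinner (c *\<^sub>C x) y = c * cinner x y"
    and Re_cinner: "Re (cinner x y) = inner x y"

interpretation cvector: vector_space "scaleC :: complex \<Rightarrow> 'a::chilbert_space \<Rightarrow> 'a"
proof
  show "1 *\<^sub>C x = x" for x :: 'a
    using scaleC_of_real[of 1 x] by simp
qed (simp_all add: scaleC_add_right scaleC_add_left scaleC_scaleC)

lemma cinner_self: "cinner x x = complex_of_real ((norm x)\<^sup>2)" for x :: "'a::chilbert_space"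
proof (rule complex_eqI)
  show "Re (cinner x x) = Re (complex_of_real ((norm x)\<^sup>2))"
    by (simp add: Re_cinner power2_norm_eq_inner)
  show "Im (cinner x x) = Im (complex_of_real ((norm x)\<^sup>2))"
    using arg_cong[OF cinner_commute[of x x], of Im] by simp
qed

instantiation complex :: chilbert_space
begin

definition scaleC_complex :: "complex \<Rightarrow> complex \<Rightarrow> complex"
  where "scaleC_complex c x = c * x"

definition cinner_complex :: "complex \<Rightarrow> complex \<Rightarrow> complex"
  where "cinner_complex x y = x * cnj y"

instance
  by standard
    (simp_all add: scaleC_complex_def cinner_complex_def inner_complex_def scaleR_conv_of_real
      algebra_simps)

end

section \<open>Unitary representations and Kazhdan constants\<close>

text \<open>
  \<open>H\<close> is a closed complex subspace of \<open>'v\<close>, hence itself a complex Hilbert space, and only the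
  restrictions of the maps \<open>\<pi> g\<close> to \<open>H\<close> matter. Surjectivity of these restrictions
  follows from the group action laws.
\<close>

locale unitary_representation = group G for G (structure) +
  fixes H :: "'v::chilbert_space set" and \<pi> :: "'a \<Rightarrow> 'v \<Rightarrow> 'v"
  assumes subspace_H: "cvector.subspace H"
    and closed_H: "closed H"
    and rep_closed: "g \<in> carrier G \<Longrightarrow> x \<in> H \<Longrightarrow> \<pi> g x \<in> H"
    and rep_add: "g \<in> carrier G \<Longrightarrow> x \<in> H \<Longrightarrow> y \<in> H \<Longrightarrow> \<pi> g (x + y) = \<pi> g x + \<pi> g y"
    and rep_scaleC: "g \<in> carrier G \<Longrightarrow> x \<in> H \<Longrightarrow> \<pi> g (c *\<^sub>C x) = c *\<^sub>C \<pi> g x"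
    and rep_cinner: "g \<in> carrier G \<Longrightarrow> x \<in> H \<Longrightarrow> y \<in> H \<Longrightarrow> cinner (\<pi> g x) (\<pi> g y) = cinner x y"
    and rep_one: "x \<in> H \<Longrightarrow> \<pi> \<one> x = x"
    and rep_mult: "g \<in> carrier G \<Longrightarrow> h \<in> carrier G \<Longrightarrow> x \<in> H \<Longrightarrow> \<pi> (g \<otimes> h) x = \<pi> g (\<pi> h x)"

definition no_invariant_vectors ::
    "('g, 'm) monoid_scheme \<Rightarrow> 'v::chilbert_space set \<Rightarrow> ('g \<Rightarrow> 'v \<Rightarrow> 'v) \<Rightarrow> bool"
  where "no_invariant_vectors G H \<pi> \<longleftrightarrow> (\<forall>v\<in>H. (\<forall>g\<in>carrier G. \<pi> g v = v) \<longrightarrow> v = 0)"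

definition rep_kazhdan_constant ::
    "'g set \<Rightarrow> 'v::chilbert_space set \<Rightarrow> ('g \<Rightarrow> 'v \<Rightarrow> 'v) \<Rightarrow> ereal"
  where "rep_kazhdan_constant S H \<pi> =
    Inf {ereal \<epsilon> | \<epsilon>. \<epsilon> > 0 \<and> (\<exists>v\<in>H. v \<noteq> 0 \<and> (\<forall>s\<in>S. norm (\<pi> s v - v) \<le> \<epsilon> * norm v))}"

text \<open>
  A definition cannot quantify over all types, so the Kazhdan constant is taken relative to an
  ambient Hilbert space \<open>'v\<close>: the infimum ranges over all representations on closed
  subspaces of \<open>'v\<close>, that is, up to isomorphism, on all complex Hilbert spaces of
  dimension at most that of \<open>'v\<close>. A lower bound on the Kazhdan constant is a lower bound for
  every \<open>'v\<close>. The values are extended reals so that the infimum of the empty set is \<open>\<infinity>\<close>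
  (on \<open>real\<close> it would be an unspecified number).
\<close>

definition kazhdan_constant ::
    "'v::chilbert_space itself \<Rightarrow> ('g, 'm) monoid_scheme \<Rightarrow> 'g set \<Rightarrow> ereal"
  where "kazhdan_constant (T :: 'v itself) G S =
    (INF (H, \<pi>) \<in> {(H :: 'v set, \<pi>). unitary_representation G H \<pi> \<and> no_invariant_vectors G H \<pi>}.
       rep_kazhdan_constant S H \<pi>)"

section \<open>\<open>A\<^sub>2\<close>-systems\<close>

definition commutator_subgroup ::
    "('g, 'm) monoid_scheme \<Rightarrow> 'g set \<Rightarrow> 'g set \<Rightarrow> 'g set"
  where "commutator_subgroup G A B =
    generate G {a \<otimes>\<^bsub>G\<^esub> b \<otimes>\<^bsub>G\<^esub> inv\<^bsub>G\<^esub> a \<otimes>\<^bsub>G\<^esub> inv\<^bsub>G\<^esub> b | a b. a \<in> A \<and> b \<in> B}"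

text \<open>
  The values \<open>X i j\<close> matter only for distinct \<open>i, j \<in> {1, 2, 3}\<close>. Permutations of
  \<open>{1, 2, 3}\<close> are the triples with \<open>{i, j, k} = {1, 2, 3}\<close>; this forces \<open>i\<close>, \<open>j\<close>, \<open>k\<close> to be distinct.
\<close>

locale A2_system = group G for G (structure) +
  fixes X :: "nat \<Rightarrow> nat \<Rightarrow> 'a set"
  assumes subgroup_X: "i \<in> {1, 2, 3} \<Longrightarrow> j \<in> {1, 2, 3} \<Longrightarrow> i \<noteq> j \<Longrightarrow> subgroup (X i j) G"
    and generate_X: "generate G (\<Union>{X i j | i j. i \<in> {1, 2, 3} \<and> j \<in> {1, 2, 3} \<and> i \<noteq> j}) = carrier G"
    and abelian_X: "{i, j, k} = {1, 2, 3} \<Longrightarrow> comm_group (G\<lparr>carrier := X i j\<rparr>)"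
    and commute_row: "{i, j, k} = {1, 2, 3} \<Longrightarrow> x \<in> X i j \<Longrightarrow> y \<in> X i k \<Longrightarrow> x \<otimes> y = y \<otimes> x"
    and commute_col: "{i, j, k} = {1, 2, 3} \<Longrightarrow> x \<in> X j i \<Longrightarrow> y \<in> X k i \<Longrightarrow> x \<otimes> y = y \<otimes> x"
    and commutator_X: "{i, j, k} = {1, 2, 3} \<Longrightarrow> commutator_subgroup G (X i j) (X j k) = X i k"

end

theory Submission
  imports Defs
begin

text \<open>
  Arrange the six roots in cyclic order 12, 13, 23, 21, 31, 32 and number them by the integers
  modulo 6. Neighbours \<open>X\<^sub>i\<close>, \<open>X\<^sub>i\<^sub>+\<^sub>1\<close> commute, and \<open>X\<^sub>i\<close> is the
  commutator subgroup of \<open>X\<^sub>i\<^sub>-\<^sub>1\<close> and \<open>X\<^sub>i\<^sub>+\<^sub>1\<close>. In a unitary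
  representation let \<open>E\<^sub>i\<close> be the fixed space of \<open>X\<^sub>i\<close>, let \<open>V\<^sub>i\<close> be the fixed space
  of \<open>\<langle>X\<^sub>i\<^sub>-\<^sub>1, X\<^sub>i\<^sub>+\<^sub>1\<rangle>\<close>, and let \<open>Q\<^sub>i\<close>, \<open>P\<^sub>i\<close> be the orthogonal
  projections onto them. Each of these groups has nilpotency class at most two with \<open>X\<^sub>i\<close> central,
  and this is used in two complementary ways.

  \<^item> On \<open>E\<^sub>i\<close> the groups \<open>X\<^sub>i\<^sub>-\<^sub>1\<close> and \<open>X\<^sub>i\<^sub>+\<^sub>1\<close> act by commuting
    operators. Hence \<open>P\<^sub>i\<close> is the product of \<open>Q\<^sub>i\<^sub>-\<^sub>1\<close>, \<open>Q\<^sub>i\<close>, \<open>Q\<^sub>i\<^sub>+\<^sub>1\<close> in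
    either direction (\<open>P_down\<close>, \<open>P_up\<close>), and on \<open>V\<^sub>i\<close> the projection onto another \<open>V\<^sub>j\<close> can be
    computed by walking to \<open>j\<close> along the hexagon; for opposite \<open>i\<close> and \<open>j\<close> both ways around
    give the same result.

  \<^item> On the orthogonal complement of \<open>E\<^sub>i\<close> the fixed spaces of \<open>X\<^sub>i\<^sub>-\<^sub>1\<close> and
    \<open>X\<^sub>i\<^sub>+\<^sub>1\<close> meet at an angle with cosine at most \<open>1 / sqrt 2\<close>, as in a Heisenberg group
    with nontrivial central character (\<open>angle_class_two\<close>).

  Write \<open>T\<close> for the compression \<open>P\<^sub>i P\<^sub>i\<^sub>+\<^sub>3 P\<^sub>i\<close> to \<open>V\<^sub>i\<close>. Walking both ways around shows
  that \<open>T\<close> is compatible with the steps \<open>V\<^sub>i \<rightarrow> V\<^sub>i\<^sub>-\<^sub>1\<close>, and the angle bound then says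
  that a vector on which \<open>T\<close> is larger than 1/2 loses nothing in such a step
  (\<open>opposite_decay_step\<close>). Adding up three steps leads from \<open>V\<^sub>i\<close> to the opposite space and yields
  \<open>(1 - T) (1/2 - T) \<ge> 0\<close> (\<open>opposite_decay\<close>): the spectrum of \<open>T\<close> avoids the open interval from
  1/2 to 1. The value 1 belongs to \<open>V\<^sub>i \<inter> V\<^sub>i\<^sub>+\<^sub>3\<close>, which consists of invariant vectors of
  \<open>G\<close> and therefore is 0. So the cosine of the angle between opposite spaces is at most
  \<open>1 / sqrt 2\<close> (\<open>opposite_angle\<close>); alternating projections replace the spectral theorem here.

  A vector \<open>v\<close> moved by at most \<open>\<epsilon> \<parallel>v\<parallel>\<close> by every element of a subgroup lies within
  \<open>(\<epsilon> / sqrt 2) \<parallel>v\<parallel>\<close> of its fixed space. Being that close to both \<open>V\<^sub>1\<close> and \<open>V\<^sub>4\<close> is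
  incompatible with the angle bound unless \<open>\<epsilon> \<ge> (sqrt 2) / 3\<close>, which exceeds 3/8. If only the root
  subgroups move \<open>v\<close> little, the product formula for \<open>P\<^sub>i\<close> costs a factor of three, leaving
  \<open>\<epsilon> \<ge> (sqrt 2) / 9\<close>, which exceeds 1/8.

  Only the real part of the Hermitian form enters, so the geometry is developed in real Hilbert
  spaces.
\<close>

section \<open>Orthogonal projections in real Hilbert spaces\<close>

instance chilbert_space \<subseteq> banach ..

lemma minimal_norm_unique:
  fixes C :: "'v::real_inner set"
  assumes "convex C" and m: "m \<in> C" "\<And>c. c \<in> C \<Longrightarrow> norm m \<le> norm c"
    and x: "x \<in> C" "norm x \<le> norm m"
  shows "x = m"
proof -
  have "(1/2) *\<^sub>R (x + m) \<in> C"
    using convexD[OF assms(1) x(1) m(1), of "1/2" "1/2"] by (simp add: scaleR_right_distrib)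
  then have "norm m \<le> norm ((1/2) *\<^sub>R (x + m))"
    by (rule m(2))
  then have "(2 * norm m)\<^sup>2 \<le> (norm (x + m))\<^sup>2"
    by (intro power_mono) auto
  moreover have "(norm (x - m))\<^sup>2 = 2 * (norm x)\<^sup>2 + 2 * (norm m)\<^sup>2 - (norm (x + m))\<^sup>2"
    by (simp add: power2_norm_eq_inner algebra_simps inner_commute)
  moreover have "(norm x)\<^sup>2 \<le> (norm m)\<^sup>2"
    using x(2) by (intro power_mono) auto
  ultimately have "(norm (x - m))\<^sup>2 \<le> 0"
    by (simp add: power2_eq_square)
  then show ?thesis by simp
qed

text \<open>
  By the parallelogram law, two points of \<open>C\<close> whose norms are nearly minimal are close to each
  other, since their midpoint lies in \<open>C\<close> as well. A minimizing sequence is therefore Cauchy.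
\<close>

lemma exists_minimal_norm:
  fixes C :: "'v::{real_inner,banach} set"
  assumes C: "closed C" "convex C" "C \<noteq> {}"
  shows "\<exists>m\<in>C. \<forall>c\<in>C. norm m \<le> norm c"
proof -
  define d where "d = Inf (norm ` C)"
  have bdd: "bdd_below (norm ` C)"
    by (intro bdd_belowI[of _ 0]) auto
  have d_le: "d \<le> norm c" if "c \<in> C" for c
    unfolding d_def using that bdd by (intro cInf_lower) auto
  have d0: "0 \<le> d"
    unfolding d_def using C(3) by (intro cInf_greatest) auto
  have "\<exists>c\<in>C. norm c < d + 1 / real (Suc n)" for n
    using cInf_lessD[of "norm ` C" "d + 1 / real (Suc n)"] C(3) d_def by auto
  then obtain c where c: "\<And>n. c n \<in> C" "\<And>n. norm (c n) < d + 1 / real (Suc n)"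
    by metis
  have lim_norm: "(\<lambda>n. norm (c n)) \<longlonglongrightarrow> d"
  proof (rule tendsto_sandwich[of "\<lambda>_. d" _ _ "\<lambda>n. d + 1 / real (Suc n)"])
    show "(\<lambda>n. d + 1 / real (Suc n)) \<longlonglongrightarrow> d"
      using tendsto_add[OF tendsto_const LIMSEQ_inverse_real_of_nat, of d]
      by (simp add: inverse_eq_divide)
  qed (use d_le c in \<open>auto intro!: always_eventually less_imp_le simp del: of_nat_Suc\<close>)
  have mid: "(norm (x - y))\<^sup>2 \<le> 2 * (norm x)\<^sup>2 + 2 * (norm y)\<^sup>2 - 4 * d\<^sup>2" if "x \<in> C" "y \<in> C" for x y
  proof -
    have "(1/2) *\<^sub>R (x + y) \<in> C"
      using convexD[OF C(2) that, of "1/2" "1/2"] by (simp add: scaleR_right_distrib)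
    then have "d \<le> norm ((1/2) *\<^sub>R (x + y))"
      by (rule d_le)
    then have "(2 * d)\<^sup>2 \<le> (norm (x + y))\<^sup>2"
      using d0 by (intro power_mono) auto
    moreover have "(norm (x - y))\<^sup>2 = 2 * (norm x)\<^sup>2 + 2 * (norm y)\<^sup>2 - (norm (x + y))\<^sup>2"
      by (simp add: power2_norm_eq_inner algebra_simps inner_commute)
    ultimately show ?thesis by (simp add: power2_eq_square)
  qed
  have "Cauchy c"
  proof (rule metric_CauchyI)
    fix e :: real assume "0 < e"
    have "(\<lambda>n. (norm (c n))\<^sup>2) \<longlonglongrightarrow> d\<^sup>2"
      by (intro tendsto_intros lim_norm)
    then have "\<forall>\<^sub>F n in sequentially. (norm (c n))\<^sup>2 < d\<^sup>2 + e\<^sup>2 / 4"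
      using \<open>0 < e\<close> by (intro order_tendstoD) auto
    then obtain N where N: "\<And>n. n \<ge> N \<Longrightarrow> (norm (c n))\<^sup>2 < d\<^sup>2 + e\<^sup>2 / 4"
      by (auto simp: eventually_sequentially)
    have "dist (c m) (c n) < e" if "m \<ge> N" "n \<ge> N" for m n
    proof -
      have "(norm (c m - c n))\<^sup>2 < e\<^sup>2"
        using mid[OF c(1) c(1), of m n] N[OF that(1)] N[OF that(2)] by argo
      then show ?thesis
        using \<open>0 < e\<close> by (simp add: dist_norm power2_less_imp_less)
    qed
    then show "\<exists>M. \<forall>m\<ge>M. \<forall>n\<ge>M. dist (c m) (c n) < e" by blast
  qed
  then obtain m where m: "c \<longlonglongrightarrow> m"
    by (auto simp: Cauchy_convergent_iff convergent_def)
  have "m \<in> C"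
    using C(1) c(1) m closed_sequentially by blast
  moreover have "norm m = d"
    using LIMSEQ_unique[OF tendsto_norm[OF m] lim_norm] .
  ultimately show ?thesis using d_le by auto
qed

abbreviation closed_linear :: "'v::real_normed_vector set \<Rightarrow> bool"
  where "closed_linear S \<equiv> subspace S \<and> closed S"

definition orth_proj :: "'v::real_inner set \<Rightarrow> 'v \<Rightarrow> 'v"
  where "orth_proj S v = (THE p. p \<in> S \<and> (\<forall>s\<in>S. inner (v - p) s = 0))"

lemma orth_proj_eqI:
  assumes "subspace S" "p \<in> S" "\<And>s. s \<in> S \<Longrightarrow> inner (v - p) s = 0"
  shows "orth_proj S v = p"
  unfolding orth_proj_def
proof (rule the_equality)
  fix q assume q: "q \<in> S \<and> (\<forall>s\<in>S. inner (v - q) s = 0)"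
  have "inner (v - p) (q - p) = 0" "inner (v - q) (q - p) = 0"
    using assms q subspace_diff[OF assms(1)] by auto
  then have "inner (q - p) (q - p) = 0"
    by (simp add: inner_diff_left)
  then show "q = p" by simp
qed (use assms in auto)

lemma exists_orthogonal_foot:
  fixes S :: "'v::{real_inner,banach} set"
  assumes S: "closed_linear S"
  shows "\<exists>p\<in>S. \<forall>s\<in>S. inner (v - p) s = 0"
proof -
  define C where "C = {x. v - x \<in> S}"
  have "closed C"
    unfolding C_def using S closed_vimage[of S "\<lambda>x. v - x"]
    by (simp add: vimage_def continuous_intros)
  moreover have "convex C"
  proof (rule convexI)
    fix x y and a b :: real assume xy: "x \<in> C" "y \<in> C" and ab: "a + b = 1"
    have "a *\<^sub>R (v - x) + b *\<^sub>R (v - y) \<in> S"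
      using S xy by (auto simp: C_def intro: subspace_add subspace_scale)
    moreover have "a *\<^sub>R (v - x) + b *\<^sub>R (v - y) = v - (a *\<^sub>R x + b *\<^sub>R y)"
      using scaleR_left.add[of a b v] ab by (simp add: algebra_simps)
    ultimately show "a *\<^sub>R x + b *\<^sub>R y \<in> C" by (simp add: C_def)
  qed
  moreover have "v \<in> C"
    using S by (simp add: C_def subspace_0)
  ultimately obtain m where m: "m \<in> C" "\<And>c. c \<in> C \<Longrightarrow> norm m \<le> norm c"
    using exists_minimal_norm[of C] by auto
  have "inner m s = 0" if s: "s \<in> S" for s
  proof (cases "s = 0")
    case False
    \<comment> \<open>\<open>t\<close> minimizes the norm of \<open>m - t *\<^sub>R s\<close>.\<close>
    define t where "t = inner m s / inner s s"
    have "(v - m) + t *\<^sub>R s \<in> S"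
      using S s m(1) by (auto simp: C_def intro: subspace_add subspace_scale)
    moreover have "v - (m - t *\<^sub>R s) = (v - m) + t *\<^sub>R s" by simp
    ultimately have "m - t *\<^sub>R s \<in> C"
      unfolding C_def by (simp only: mem_Collect_eq)
    then have "(norm m)\<^sup>2 \<le> (norm (m - t *\<^sub>R s))\<^sup>2"
      by (intro power_mono m) auto
    also have "\<dots> = (norm m)\<^sup>2 - t * inner m s"
      using False by (simp add: power2_norm_eq_inner algebra_simps inner_commute t_def)
    finally have "(inner m s)\<^sup>2 / inner s s \<le> 0"
      by (simp add: t_def power2_eq_square)
    moreover have "0 < inner s s"
      using False by simp
    ultimately have "(inner m s)\<^sup>2 \<le> 0"
      by (simp only: pos_divide_le_eq mult_zero_left)
    then show ?thesis by simp
  qed simp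
  then show ?thesis
    using m(1) by (intro bexI[of _ "v - m"]) (auto simp: C_def)
qed

lemma
  fixes S :: "'v::{real_inner,banach} set"
  assumes S: "closed_linear S"
  shows orth_proj_in: "orth_proj S v \<in> S"
    and orth_proj_orth: "s \<in> S \<Longrightarrow> inner (v - orth_proj S v) s = 0"
  using exists_orthogonal_foot[OF S, of v] orth_proj_eqI[of S _ v] S by auto

lemma inner_orth_proj:
  fixes S :: "'v::{real_inner,banach} set"
  assumes "closed_linear S" "s \<in> S"
  shows "inner (orth_proj S v) s = inner v s"
  using orth_proj_orth[OF assms, of v] by (simp add: inner_diff_left)

lemma orth_proj_self: "subspace S \<Longrightarrow> v \<in> S \<Longrightarrow> orth_proj S v = v"
  by (rule orth_proj_eqI) auto

lemma norm_diff_orth_proj: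
  fixes S :: "'v::{real_inner,banach} set"
  assumes "closed_linear S"
  shows "(norm (v - orth_proj S v))\<^sup>2 = (norm v)\<^sup>2 - (norm (orth_proj S v))\<^sup>2"
proof -
  have "inner (orth_proj S v) (orth_proj S v) = inner v (orth_proj S v)"
    by (rule inner_orth_proj[OF assms orth_proj_in[OF assms]])
  then show ?thesis
    by (simp add: power2_norm_eq_inner inner_diff_left inner_diff_right inner_commute)
qed

lemma orth_proj_closest:
  fixes S :: "'v::{real_inner,banach} set"
  assumes S: "closed_linear S" and "s \<in> S"
  shows "norm (v - orth_proj S v) \<le> norm (v - s)"
proof -
  let ?p = "orth_proj S v"
  have "inner (v - ?p) (?p - s) = 0"
    using assms by (intro orth_proj_orth) (auto intro: subspace_diff orth_proj_in)
  then have "(norm ((v - ?p) + (?p - s)))\<^sup>2 = (norm (v - ?p))\<^sup>2 + (norm (?p - s))\<^sup>2"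
    by (intro norm_add_Pythagorean) (simp only: orthogonal_def)
  moreover have "(v - ?p) + (?p - s) = v - s" by simp
  ultimately have "(norm (v - ?p))\<^sup>2 \<le> (norm (v - s))\<^sup>2"
    by (metis le_add_same_cancel1 zero_le_power2)
  then show ?thesis
    by (rule power2_le_imp_le) simp
qed

lemma orth_proj_diff:
  fixes S :: "'v::{real_inner,banach} set"
  assumes S: "closed_linear S"
  shows "orth_proj S (x - y) = orth_proj S x - orth_proj S y"
  using S orth_proj_in[OF S] by (intro orth_proj_eqI)
    (auto simp: inner_diff_left inner_orth_proj[OF S] intro: subspace_diff)

lemma norm_orth_proj_le:
  fixes S :: "'v::{real_inner,banach} set"
  assumes "closed_linear S"
  shows "norm (orth_proj S v) \<le> norm v"
proof (rule power2_le_imp_le)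
  have "0 \<le> (norm (v - orth_proj S v))\<^sup>2" by simp
  then show "(norm (orth_proj S v))\<^sup>2 \<le> (norm v)\<^sup>2"
    unfolding norm_diff_orth_proj[OF assms] by linarith
qed simp

text \<open>
  Products of projections collapse to one projection as soon as one of them preserves the range of
  the other. This turns commutation of groups into identities between projections.
\<close>

lemma orth_proj_orth_proj:
  fixes S T :: "'v::{real_inner,banach} set"
  assumes S: "closed_linear S" and T: "closed_linear T"
    and "\<And>t. t \<in> T \<Longrightarrow> orth_proj S t \<in> T"
  shows "orth_proj S (orth_proj T v) = orth_proj (S \<inter> T) v"
proof (rule sym, rule orth_proj_eqI)
  let ?p = "orth_proj S (orth_proj T v)"
  show "subspace (S \<inter> T)" using S T by (simp add: subspace_inter)
  show "?p \<in> S \<inter> T" using assms orth_proj_in by blast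
  fix s assume "s \<in> S \<inter> T"
  then show "inner (v - ?p) s = 0"
    by (simp add: inner_diff_left inner_orth_proj S T)
qed

section \<open>Two subspaces with geometrically decaying alternating projections\<close>

text \<open>
  For \<open>A = 1 - P\<^sub>S P\<^sub>T\<close> on \<open>S\<close> the hypothesis \<open>decayS\<close> reads \<open>A\<^sup>2 \<ge> A / 2\<close>, while
  \<open>S \<inter> T = 0\<close> makes \<open>A\<close> injective, so that the spectrum of \<open>A\<close> lies above 1/2; this is the
  conclusion. Instead of using spectral theory, project back and forth between \<open>S\<close> and \<open>T\<close>: the
  squared step lengths at least halve each time, so the process converges, to a point of
  \<open>S \<inter> T\<close>, and the squared norm of \<open>z\<close>, which is the sum of all squared step lengths, is at most
  twice the first of them.
\<close>

lemma alternating_projections_bound: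
  fixes S T :: "'v::{real_inner,banach} set"
  assumes S: "closed_linear S" and T: "closed_linear T" and ST: "S \<inter> T \<subseteq> {0}"
    and decayS: "\<And>z. z \<in> S \<Longrightarrow> 2 * ((norm (orth_proj T z))\<^sup>2 - (norm (orth_proj S (orth_proj T z)))\<^sup>2)
                    \<le> (norm z)\<^sup>2 - (norm (orth_proj T z))\<^sup>2"
    and decayT: "\<And>z. z \<in> T \<Longrightarrow> 2 * ((norm (orth_proj S z))\<^sup>2 - (norm (orth_proj T (orth_proj S z)))\<^sup>2)
                    \<le> (norm z)\<^sup>2 - (norm (orth_proj S z))\<^sup>2"
    and z: "z \<in> S"
  shows "2 * (norm (orth_proj T z))\<^sup>2 \<le> (norm z)\<^sup>2"
proof -
  define w where "w = rec_nat z (\<lambda>n x. if even n then orth_proj T x else orth_proj S x)"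
  have w0: "w 0 = z" and wSuc: "\<And>n. w (Suc n) = (if even n then orth_proj T (w n) else orth_proj S (w n))"
    by (simp_all add: w_def)
  have w_mem: "even n \<longrightarrow> w n \<in> S" "odd n \<longrightarrow> w n \<in> T" for n
    by (induction n) (use z orth_proj_in[OF S] orth_proj_in[OF T] in \<open>auto simp: w0 wSuc\<close>)
  define e where "e n = (norm (w n - w (Suc n)))\<^sup>2" for n
  have e_eq: "e n = (norm (w n))\<^sup>2 - (norm (w (Suc n)))\<^sup>2" for n
    by (simp add: e_def wSuc norm_diff_orth_proj S T)
  have e_half: "2 * e (Suc n) \<le> e n" for n
    using decayS[of "w n"] decayT[of "w n"] w_mem[of n] by (cases "even n") (simp_all add: e_eq wSuc)
  have e_le: "e n \<le> e 0 * (1/2) ^ n" for n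
  proof (induction n)
    case (Suc n)
    then show ?case using e_half[of n] by simp
  qed simp
  have w_step: "norm (w (Suc n) - w n) \<le> sqrt (e 0) * (sqrt (1/2)) ^ n" for n
  proof -
    have "norm (w (Suc n) - w n) = sqrt (e n)"
      by (simp add: e_def norm_minus_commute)
    also have "\<dots> \<le> sqrt (e 0 * (1/2) ^ n)"
      using e_le[of n] by simp
    finally show ?thesis by (simp add: real_sqrt_mult real_sqrt_power)
  qed
  have "summable (\<lambda>n. sqrt (e 0) * (sqrt (1/2)) ^ n)"
    by (intro summable_mult summable_geometric) simp
  then have "summable (\<lambda>n. w (Suc n) - w n)"
    by (rule summable_comparison_test'[where N = 0]) (rule w_step)
  then have "(\<lambda>n. \<Sum>k<n. w (Suc k) - w k) \<longlonglongrightarrow> (\<Sum>n. w (Suc n) - w n)"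
    by (rule summable_LIMSEQ)
  then have "(\<lambda>n. w n - z) \<longlonglongrightarrow> (\<Sum>n. w (Suc n) - w n)"
    by (simp add: sum_lessThan_telescope w0)
  then have "(\<lambda>n. (w n - z) + z) \<longlonglongrightarrow> (\<Sum>n. w (Suc n) - w n) + z"
    by (intro tendsto_add tendsto_const)
  then obtain l where l: "w \<longlonglongrightarrow> l" by auto
  have "(\<lambda>n. w (2 * n)) \<longlonglongrightarrow> l"
    using LIMSEQ_subseq_LIMSEQ[OF l, of "\<lambda>n. 2 * n"] by (simp add: strict_mono_def o_def)
  moreover have "(\<lambda>n. w (2 * n + 1)) \<longlonglongrightarrow> l"
    using LIMSEQ_subseq_LIMSEQ[OF l, of "\<lambda>n. 2 * n + 1"] by (simp add: strict_mono_def o_def)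
  ultimately have "l \<in> S \<inter> T"
    using closed_sequentially[of S "\<lambda>n. w (2 * n)" l] closed_sequentially[of T "\<lambda>n. w (2 * n + 1)" l]
      S T w_mem by auto
  then have "l = 0" using ST by auto
  \<comment> \<open>Halving makes \<open>(norm (w n))\<^sup>2 - 2 * e n\<close> nondecreasing.\<close>
  have pot: "(norm z)\<^sup>2 - 2 * e 0 \<le> (norm (w n))\<^sup>2" for n
  proof -
    have "(norm z)\<^sup>2 - 2 * e 0 \<le> (norm (w n))\<^sup>2 - 2 * e n"
    proof (induction n)
      case (Suc n)
      then show ?case using e_half[of n] e_eq[of n] by linarith
    qed (simp add: w0)
    moreover have "0 \<le> e n" by (simp add: e_def)
    ultimately show ?thesis by linarith
  qed
  have "(\<lambda>n. (norm (w n))\<^sup>2) \<longlonglongrightarrow> (norm l)\<^sup>2"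
    by (intro tendsto_intros l)
  then have "(norm z)\<^sup>2 - 2 * e 0 \<le> (norm l)\<^sup>2"
    by (rule LIMSEQ_le_const) (use pot in blast)
  then show ?thesis
    using e_eq[of 0] by (simp add: \<open>l = 0\<close> w0 wSuc)
qed

text \<open>
  The projection of \<open>v\<close> to \<open>S\<close> is nearly as long as \<open>v\<close> and, by the angle bound, far from \<open>T\<close>; yet
  it is close to \<open>v\<close>, which is close to \<open>T\<close>.
\<close>

lemma distance_to_both_subspaces:
  fixes S T :: "'v::{real_inner,banach} set"
  assumes S: "closed_linear S" and T: "closed_linear T"
    and angle: "\<And>z. z \<in> S \<Longrightarrow> 2 * (norm (orth_proj T z))\<^sup>2 \<le> (norm z)\<^sup>2"
    and r: "norm (v - orth_proj S v) \<le> r * norm v" "norm (v - orth_proj T v) \<le> r * norm v"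
    and "v \<noteq> 0"
  shows "1 \<le> 9 * r\<^sup>2"
proof -
  let ?p = "orth_proj S v"
  have "norm (?p - orth_proj T ?p) \<le> norm (?p - orth_proj T v)"
    by (intro orth_proj_closest orth_proj_in T)
  also have "\<dots> \<le> norm (v - ?p) + norm (v - orth_proj T v)"
    using norm_triangle_ineq4[of "v - orth_proj T v" "v - ?p"] by simp
  also have "\<dots> \<le> 2 * r * norm v"
    using r by simp
  finally have "(norm (?p - orth_proj T ?p))\<^sup>2 \<le> (2 * r * norm v)\<^sup>2"
    by (intro power_mono) auto
  moreover have "(norm ?p)\<^sup>2 \<le> 2 * (norm (?p - orth_proj T ?p))\<^sup>2"
    using angle[OF orth_proj_in[OF S, of v]] by (simp add: norm_diff_orth_proj T)
  moreover have "(norm v)\<^sup>2 - (norm ?p)\<^sup>2 \<le> (r * norm v)\<^sup>2"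
    using power_mono[OF r(1), of 2] by (simp add: norm_diff_orth_proj S)
  ultimately have "(norm v)\<^sup>2 \<le> 9 * (r\<^sup>2 * (norm v)\<^sup>2)"
    unfolding power_mult_distrib by simp
  then have "(norm v)\<^sup>2 * 1 \<le> (norm v)\<^sup>2 * (9 * r\<^sup>2)"
    by (simp add: mult_ac)
  then show ?thesis using \<open>v \<noteq> 0\<close> by (simp add: mult_le_cancel_left)
qed

section \<open>Hexagons of subspaces\<close>

text \<open>
  The geometry extracted from an \<open>A\<^sub>2\<close>-system: \<open>E i\<close> stands for the fixed space of the \<open>i\<close>-th
  root subgroup. The conditions \<open>proj_next\<close> and \<open>proj_prev\<close> reflect that neighbouring root
  subgroups commute, \<open>proj_up\<close> and \<open>proj_down\<close> that the two neighbours of a root subgroup act by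
  commuting operators on its fixed space. Indexing by all integers, with period 6, makes every
  statement invariant under rotation of the hexagon.
\<close>

locale subspace_hexagon =
  fixes E :: "int \<Rightarrow> 'v::{real_inner,banach} set"
  assumes closed_linear_E: "closed_linear (E i)"
    and periodic: "E (i + 6) = E i"
    and proj_next: "v \<in> E (i + 1) \<Longrightarrow> orth_proj (E i) v \<in> E (i + 1)"
    and proj_prev: "v \<in> E (i - 1) \<Longrightarrow> orth_proj (E i) v \<in> E (i - 1)"
    and proj_up: "v \<in> E i \<Longrightarrow> v \<in> E (i - 1) \<Longrightarrow> orth_proj (E (i + 1)) v \<in> E (i - 1)"
    and proj_down: "v \<in> E i \<Longrightarrow> v \<in> E (i + 1) \<Longrightarrow> orth_proj (E (i - 1)) v \<in> E (i + 1)"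
    and meet_subset: "E (i - 1) \<inter> E (i + 1) \<subseteq> E i"
    and angle: "u \<in> E (i - 1) \<Longrightarrow> w \<in> E (i + 1) \<Longrightarrow> (\<And>s. s \<in> E i \<Longrightarrow> inner u s = 0)
      \<Longrightarrow> (\<And>s. s \<in> E i \<Longrightarrow> inner w s = 0) \<Longrightarrow> 2 * (inner u w)\<^sup>2 \<le> (norm u)\<^sup>2 * (norm w)\<^sup>2"
begin

abbreviation Q :: "int \<Rightarrow> 'v \<Rightarrow> 'v"
  where "Q i \<equiv> orth_proj (E i)"

definition V :: "int \<Rightarrow> 'v set"
  where "V i = E (i - 1) \<inter> E (i + 1)"

abbreviation P :: "int \<Rightarrow> 'v \<Rightarrow> 'v"
  where "P i \<equiv> orth_proj (V i)"

lemma V_subset: "v \<in> V i \<Longrightarrow> v \<in> E (i - 1) \<and> v \<in> E i \<and> v \<in> E (i + 1)"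
  using meet_subset[of i] by (auto simp: V_def)

lemma V_eq: "V i = E (i - 1) \<inter> (E i \<inter> E (i + 1))"
  using meet_subset[of i] by (auto simp: V_def)

lemma closed_linear_V: "closed_linear (V i)"
  using closed_linear_E by (auto simp: V_def intro: subspace_inter)

lemma V_periodic: "V (i + 6) = V i"
  using periodic[of "i - 1"] periodic[of "i + 1"] by (simp add: V_def algebra_simps)

lemma P_down: "P i v = Q (i - 1) (Q i (Q (i + 1) v))"
proof -
  have "Q i (Q (i + 1) v) = orth_proj (E i \<inter> E (i + 1)) v"
    by (rule orth_proj_orth_proj[OF closed_linear_E closed_linear_E proj_next])
  moreover have "Q (i - 1) (orth_proj (E i \<inter> E (i + 1)) v) = P i v"
    unfolding V_eq using closed_linear_E proj_next[of _ "i - 1"] proj_down[of _ i]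
    by (intro orth_proj_orth_proj) (auto intro: subspace_inter)
  ultimately show ?thesis by simp
qed

lemma P_up: "P i v = Q (i + 1) (Q i (Q (i - 1) v))"
proof -
  have "Q i (Q (i - 1) v) = orth_proj (E i \<inter> E (i - 1)) v"
    by (rule orth_proj_orth_proj[OF closed_linear_E closed_linear_E proj_prev])
  moreover have "Q (i + 1) (orth_proj (E i \<inter> E (i - 1)) v) = orth_proj (E (i + 1) \<inter> (E i \<inter> E (i - 1))) v"
    using closed_linear_E proj_prev[of _ "i + 1"] proj_up[of _ i]
    by (intro orth_proj_orth_proj) (auto intro: subspace_inter)
  moreover have "E (i + 1) \<inter> (E i \<inter> E (i - 1)) = V i"
    unfolding V_eq by auto
  ultimately show ?thesis by simp
qed

lemma P_in: "P i v \<in> V i"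
  by (rule orth_proj_in[OF closed_linear_V])

lemma Q_self: "v \<in> E i \<Longrightarrow> Q i v = v"
  by (rule orth_proj_self) (use closed_linear_E in blast)

lemma P_next: "v \<in> V i \<Longrightarrow> P (i + 1) v = Q (i + 2) v"
  using V_subset[of v i] P_up[of "i + 1" v] by (simp add: Q_self add.commute)

lemma P_next2: "v \<in> V i \<Longrightarrow> P (i + 2) v = Q (i + 3) (Q (i + 2) v)"
  using V_subset[of v i] P_up[of "i + 2" v] by (simp add: Q_self add.commute)

lemma P_prev: "v \<in> V i \<Longrightarrow> P (i - 1) v = Q (i - 2) v"
  using V_subset[of v i] P_down[of "i - 1" v] by (simp add: Q_self add.commute)

lemma P_prev2: "v \<in> V i \<Longrightarrow> P (i - 2) v = Q (i - 3) (Q (i - 2) v)"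
  using V_subset[of v i] P_down[of "i - 2" v] by (simp add: Q_self add.commute)

text \<open>
  Expanding every \<open>P\<close> on the right into three \<open>Q\<close>'s, all factors that do not advance along the
  hexagon act trivially, and what is left is the expansion of the single projection on the left.
  The next lemma is a part of the same computation in the other direction.
\<close>

lemma P_opposite_via_prev:
  assumes "v \<in> V i"
  shows "P (i - 3) v = P (i - 3) (P (i - 2) (P (i - 1) v))"
proof -
  have "P (i - 2) (P (i - 1) v) = P (i - 2) v"
    using P_prev[OF P_in[of "i - 1" v]] P_prev[OF assms] P_prev2[OF assms] by simp
  moreover have "P (i - 3) (P (i - 2) v) = Q (i - 4) (P (i - 2) v)"
    using P_prev[OF P_in[of "i - 2" v]] by simp
  moreover have "P (i - 3) v = Q (i - 4) (Q (i - 3) (Q (i - 2) v))"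
    using P_down[of "i - 3" v] by simp
  ultimately show ?thesis
    using P_prev2[OF assms] by simp
qed

lemma P_opposite_via_next:
  assumes "v \<in> V i"
  shows "P (i + 3) (P (i + 1) v) = P (i + 3) v"
proof -
  have "P (i + 3) (P (i + 1) v) = Q (i + 4) (Q (i + 3) (P (i + 1) v))"
    using P_next2[OF P_in[of "i + 1" v]] by (simp add: add.commute)
  also have "\<dots> = Q (i + 4) (Q (i + 3) (Q (i + 2) v))"
    by (simp add: P_next[OF assms])
  also have "\<dots> = P (i + 3) v"
    using P_up[of "i + 3" v] by (simp add: add.commute)
  finally show ?thesis .
qed

text \<open>
  Put \<open>x = P\<^sub>i\<^sub>-\<^sub>1 z\<close> and \<open>y = P\<^sub>i\<^sub>-\<^sub>3 z\<close>. As \<open>x\<close> is fixed by the \<open>i\<close>-th and \<open>y\<close> by the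
  \<open>(i+2)\<close>-nd root subgroup (\<open>i + 2\<close> is \<open>i - 4\<close> modulo 6), the angle bound at \<open>i + 1\<close> applies to
  the components \<open>u\<close>, \<open>w\<close> of \<open>x\<close>, \<open>y\<close> orthogonal to \<open>E (i + 1)\<close>. Path independence evaluates the
  inner product of \<open>u\<close> and \<open>w\<close> as the square of the norm of \<open>w\<close>: walking down from \<open>x\<close> reaches
  \<open>y\<close>, and the projections of \<open>x\<close> and of \<open>y\<close> to \<open>V (i - 4)\<close> agree. So the angle bound becomes
  \<open>2 \<parallel>w\<parallel>\<^sup>2 \<le> \<parallel>u\<parallel>\<^sup>2\<close>, and \<open>u\<close> is no longer than \<open>z - x\<close> because \<open>u\<close> is the shortest
  vector from \<open>V i\<close> to \<open>x\<close>.
\<close>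

lemma opposite_decay_step:
  assumes z: "z \<in> V i"
  shows "2 * ((norm (P (i - 3) z))\<^sup>2 - (norm (P (i - 4) (P (i - 1) z)))\<^sup>2)
    \<le> (norm z)\<^sup>2 - (norm (P (i - 1) z))\<^sup>2"
proof -
  define x y where "x = P (i - 1) z" and "y = P (i - 3) z"
  have x: "x \<in> V (i - 1)" and y: "y \<in> V (i - 3)"
    by (simp_all add: x_def y_def P_in)
  have E2: "E (i + 2) = E (i - 4)" and E1: "E (i + 1) = E (i - 5)" and V2: "V (i + 2) = V (i - 4)"
    using periodic[of "i - 4"] periodic[of "i - 5"] V_periodic[of "i - 4"]
    by (simp_all add: add.commute)
  have Px: "P (i - 4) x = P (i - 4) y"
    using P_opposite_via_prev[OF x] P_opposite_via_prev[OF z] by (simp add: x_def y_def)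
  have Qx: "Q (i + 1) x = P i x"
    using P_next[OF x] by (simp add: add.commute)
  have Qy: "Q (i + 1) y = P (i - 4) y"
    using P_prev[OF y] by (simp add: E1)
  have xE: "x \<in> E i" and yE: "y \<in> E (i + 2)"
    using V_subset[OF x] V_subset[OF y] by (simp_all add: E2)
  define u w where "u = x - Q (i + 1) x" and "w = y - Q (i + 1) y"
  have "u \<in> E i" "w \<in> E (i + 2)"
    using xE yE proj_prev[of x "i + 1"] proj_next[of y "i + 1"] closed_linear_E
    by (auto simp: u_def w_def add.commute intro: subspace_diff)
  then have "2 * (inner u w)\<^sup>2 \<le> (norm u)\<^sup>2 * (norm w)\<^sup>2"
    using angle[of u "i + 1" w] orth_proj_orth[OF closed_linear_E, of _ "i + 1" x]
      orth_proj_orth[OF closed_linear_E, of _ "i + 1" y]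
    by (simp add: u_def w_def add.commute)
  moreover have uw: "inner u w = (norm w)\<^sup>2"
  proof -
    have "inner u w = inner x w"
      using orth_proj_orth[OF closed_linear_E orth_proj_in[OF closed_linear_E], of y "i + 1" x]
      by (simp add: u_def w_def inner_diff_left inner_diff_right inner_commute
          inner_orth_proj[OF closed_linear_E orth_proj_in[OF closed_linear_E]])
    also have "\<dots> = inner x y - inner (P i x) (P (i - 4) y)"
      using inner_orth_proj[OF closed_linear_E orth_proj_in[OF closed_linear_E], of "i + 1" x y]
      by (simp add: w_def inner_diff_right Qx Qy)
    also have "inner x y = (norm y)\<^sup>2"
    proof -
      have "P (i - 3) x = y"
        using P_opposite_via_prev[OF z] P_prev[OF P_in[of "i - 2" x]] P_prev2[OF x] P_prev[OF x]
        by (simp add: x_def y_def)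
      then show ?thesis
        using inner_orth_proj[OF closed_linear_V y, of x] by (simp add: power2_norm_eq_inner)
    qed
    also have "inner (P i x) (P (i - 4) y) = inner (P (i - 4) (P i x)) (P (i - 4) y)"
      by (rule inner_orth_proj[OF closed_linear_V P_in, symmetric])
    also have "P (i - 4) (P i x) = P (i - 4) y"
      using P_opposite_via_next[OF x] V2 by (simp add: Px add.commute)
    also have "(norm y)\<^sup>2 - inner (P (i - 4) y) (P (i - 4) y) = (norm w)\<^sup>2"
      by (simp add: w_def Qy norm_diff_orth_proj[OF closed_linear_V] power2_norm_eq_inner[symmetric])
    finally show ?thesis .
  qed
  ultimately have "(norm w)\<^sup>2 * (2 * (norm w)\<^sup>2) \<le> (norm w)\<^sup>2 * (norm u)\<^sup>2"
    by (simp add: power2_eq_square mult_ac)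
  then have "2 * (norm w)\<^sup>2 \<le> (norm u)\<^sup>2"
    by (cases "w = 0") (auto simp: mult_le_cancel_left)
  also have "\<dots> \<le> (norm (x - z))\<^sup>2"
    unfolding u_def Qx by (intro power_mono orth_proj_closest closed_linear_V z) simp
  also have "\<dots> = (norm z)\<^sup>2 - (norm x)\<^sup>2"
    unfolding x_def norm_minus_commute[of _ z] by (rule norm_diff_orth_proj[OF closed_linear_V])
  finally show ?thesis
    unfolding x_def[symmetric] y_def[symmetric] Px w_def Qy norm_diff_orth_proj[OF closed_linear_V] .
qed

text \<open>
  Three steps lead from \<open>V i\<close> to \<open>V (i - 3)\<close>. The quantities bounded in
  \<open>opposite_decay_step\<close> telescope along \<open>z\<close>, \<open>z1\<close>, \<open>z2\<close>, \<open>z3\<close>.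
\<close>

lemma opposite_decay:
  assumes z: "z \<in> V i"
  shows "2 * ((norm (P (i - 3) z))\<^sup>2 - (norm (P i (P (i - 3) z)))\<^sup>2)
    \<le> (norm z)\<^sup>2 - (norm (P (i - 3) z))\<^sup>2"
proof -
  define z1 z2 z3 where "z1 = P (i - 1) z" and "z2 = P (i - 2) z1" and "z3 = P (i - 3) z2"
  have "2 * ((norm (P (i - 3) z))\<^sup>2 - (norm (P (i - 4) z1))\<^sup>2) \<le> (norm z)\<^sup>2 - (norm z1)\<^sup>2"
    using opposite_decay_step[OF z] by (simp add: z1_def)
  moreover have "2 * ((norm (P (i - 4) z1))\<^sup>2 - (norm (P (i - 5) z2))\<^sup>2) \<le> (norm z1)\<^sup>2 - (norm z2)\<^sup>2"
    using opposite_decay_step[OF P_in, of "i - 1" z] by (simp add: z1_def z2_def)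
  moreover have "2 * ((norm (P (i - 5) z2))\<^sup>2 - (norm (P (i - 6) z3))\<^sup>2) \<le> (norm z2)\<^sup>2 - (norm z3)\<^sup>2"
    using opposite_decay_step[OF P_in, of "i - 2" z1] by (simp add: z2_def z3_def)
  moreover have "z3 = P (i - 3) z"
    using P_opposite_via_prev[OF z] by (simp add: z1_def z2_def z3_def)
  moreover have "V (i - 6) = V i"
    using V_periodic[of "i - 6"] by simp
  ultimately show ?thesis by simp
qed

text \<open>
  The difference \<open>v - P i v\<close> telescopes along the three factors of \<open>P i\<close>, and projections do not
  increase norms.
\<close>

lemma norm_diff_P_le:
  "norm (v - P i v) \<le> norm (v - Q (i - 1) v) + norm (v - Q i v) + norm (v - Q (i + 1) v)"
proof -
  have "v - P i v = (v - Q (i - 1) v) + (Q (i - 1) (v - Q i v) + Q (i - 1) (Q i (v - Q (i + 1) v)))"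
    by (simp add: P_down orth_proj_diff closed_linear_E)
  also have "norm \<dots> \<le> norm (v - Q (i - 1) v)
      + (norm (Q (i - 1) (v - Q i v)) + norm (Q (i - 1) (Q i (v - Q (i + 1) v))))"
    by (intro order_trans[OF norm_triangle_ineq] add_mono order_refl norm_triangle_ineq)
  also have "\<dots> \<le> norm (v - Q (i - 1) v) + (norm (v - Q i v) + norm (v - Q (i + 1) v))"
    by (intro add_mono order_refl norm_orth_proj_le[OF closed_linear_E]
        order_trans[OF norm_orth_proj_le[OF closed_linear_E]])
  finally show ?thesis by simp
qed

theorem opposite_angle:
  assumes "(\<Inter>i\<in>{0..5}. E i) \<subseteq> {0}" and z: "z \<in> V 1"
  shows "2 * (norm (P 4 z))\<^sup>2 \<le> (norm z)\<^sup>2"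
proof (rule alternating_projections_bound[OF closed_linear_V closed_linear_V _ _ _ z])
  have "x \<in> E i" if "x \<in> V 1" "x \<in> V 4" "i \<in> {0..5}" for x i
  proof -
    \<comment> \<open>\<open>V 1\<close> lies in \<open>E 0\<close>, \<open>E 1\<close>, \<open>E 2\<close> and \<open>V 4\<close> lies in \<open>E 3\<close>, \<open>E 4\<close>, \<open>E 5\<close>.\<close>
    have "i \<in> {0, 1, 2, 3, 4, 5}" using that(3) by auto
    then show ?thesis using V_subset[OF that(1)] V_subset[OF that(2)] by auto
  qed
  then show "V 1 \<inter> V 4 \<subseteq> {0}" using assms(1) by blast
  show "2 * ((norm (P 4 z))\<^sup>2 - (norm (P 1 (P 4 z)))\<^sup>2) \<le> (norm z)\<^sup>2 - (norm (P 4 z))\<^sup>2"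
    if "z \<in> V 1" for z
    using opposite_decay[OF that] V_periodic[of "- 2"] by simp
  show "2 * ((norm (P 1 z))\<^sup>2 - (norm (P 4 (P 1 z)))\<^sup>2) \<le> (norm z)\<^sup>2 - (norm (P 1 z))\<^sup>2"
    if "z \<in> V 4" for z
    using opposite_decay[OF that] by simp
qed

end

section \<open>Fixed vectors of a unitary representation\<close>

context unitary_representation
begin

definition fixed :: "'a set \<Rightarrow> 'v set"
  where "fixed K = {v \<in> H. \<forall>g\<in>K. \<pi> g v = v}"

lemma subspace_H_real: "subspace H"
proof (rule subspaceI)
  show "0 \<in> H" by (rule cvector.subspace_0[OF subspace_H])
  show "x + y \<in> H" if "x \<in> H" "y \<in> H" for x y
    by (rule cvector.subspace_add[OF subspace_H that])
  show "r *\<^sub>R x \<in> H" if "x \<in> H" for r x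
    using cvector.subspace_scale[OF subspace_H that, of "complex_of_real r"]
    by (simp add: scaleC_of_real)
qed

lemma rep_scaleR: "g \<in> carrier G \<Longrightarrow> x \<in> H \<Longrightarrow> \<pi> g (r *\<^sub>R x) = r *\<^sub>R \<pi> g x"
  using rep_scaleC[of g x "complex_of_real r"] by (simp add: scaleC_of_real)

lemma rep_zero: "g \<in> carrier G \<Longrightarrow> \<pi> g 0 = 0"
  using rep_scaleR[of g 0 0] subspace_0[OF subspace_H_real] by simp

lemma rep_diff:
  assumes "g \<in> carrier G" "x \<in> H" "y \<in> H"
  shows "\<pi> g (x - y) = \<pi> g x - \<pi> g y"
  using rep_add[of g "x - y" y] assms subspace_diff[OF subspace_H_real, of x y]
  by (simp add: algebra_simps)

lemma rep_inner: "g \<in> carrier G \<Longrightarrow> x \<in> H \<Longrightarrow> y \<in> H \<Longrightarrow> inner (\<pi> g x) (\<pi> g y) = inner x y"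
  by (simp add: Re_cinner[symmetric] rep_cinner)

lemma rep_norm: "g \<in> carrier G \<Longrightarrow> x \<in> H \<Longrightarrow> norm (\<pi> g x) = norm x"
  by (simp add: norm_eq_sqrt_inner rep_inner)

lemma rep_inv_cancel: "g \<in> carrier G \<Longrightarrow> x \<in> H \<Longrightarrow> \<pi> (inv g) (\<pi> g x) = x"
  using rep_mult[of "inv g" g x] by (simp add: rep_one)

lemma rep_inner_inv:
  assumes "g \<in> carrier G" "x \<in> H" "y \<in> H"
  shows "inner (\<pi> g x) y = inner x (\<pi> (inv g) y)"
  using rep_inner[of "inv g" "\<pi> g x" y] assms by (simp add: rep_closed rep_inv_cancel)

lemma fixed_subset_H: "v \<in> fixed K \<Longrightarrow> v \<in> H"
  by (simp add: fixed_def)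

lemma fixed_antimono: "K \<subseteq> L \<Longrightarrow> fixed L \<subseteq> fixed K"
  by (auto simp: fixed_def)

lemma fixed_Un: "fixed (K \<union> L) = fixed K \<inter> fixed L"
  by (auto simp: fixed_def)

lemma closed_linear_fixed:
  assumes K: "K \<subseteq> carrier G"
  shows "closed_linear (fixed K)"
proof
  show "subspace (fixed K)"
    using subspace_H_real K
    by (intro subspaceI) (auto simp: fixed_def rep_zero rep_add rep_scaleR subset_iff
        intro: subspace_0 subspace_add subspace_scale)
  show "closed (fixed K)"
    unfolding closed_sequential_limits
  proof (intro allI impI)
    fix x l assume *: "(\<forall>n. x n \<in> fixed K) \<and> x \<longlonglongrightarrow> l"
    then have xH: "x n \<in> H" for n by (auto simp: fixed_def)
    have lH: "l \<in> H"
      using closed_H * xH unfolding closed_sequential_limits by blast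
    have "\<pi> g l = l" if "g \<in> K" for g
    proof -
      have g: "g \<in> carrier G" using that K by auto
      have "norm (x n - \<pi> g l) = norm (x n - l)" for n
      proof -
        have "\<pi> g (x n) = x n" using * that by (auto simp: fixed_def)
        then have "x n - \<pi> g l = \<pi> g (x n - l)"
          by (simp add: rep_diff[OF g xH lH])
        then show ?thesis
          by (simp add: rep_norm[OF g] subspace_diff[OF subspace_H_real xH lH])
      qed
      then have "x \<longlonglongrightarrow> \<pi> g l"
        using * by (simp add: LIMSEQ_iff)
      then show ?thesis using * LIMSEQ_unique by blast
    qed
    then show "l \<in> fixed K" using lH by (simp add: fixed_def)
  qed
qed

lemma fixed_generate:
  assumes K: "K \<subseteq> carrier G"
  shows "fixed (generate G K) = fixed K"
proof
  show "fixed (generate G K) \<subseteq> fixed K"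
    by (intro fixed_antimono) (auto intro: generate.incl)
  show "fixed K \<subseteq> fixed (generate G K)"
  proof
    fix v assume v: "v \<in> fixed K"
    then have vH: "v \<in> H" by (rule fixed_subset_H)
    have "\<pi> g v = v" if "g \<in> generate G K" for g
      using that
    proof induction
      case (inv h)
      then show ?case
        using rep_inv_cancel[of h v] v K vH by (auto simp: fixed_def)
    next
      case (eng g h)
      then show ?case
        using generate_in_carrier[OF K] rep_mult[of g h v] vH by simp
    qed (use v vH rep_one in \<open>auto simp: fixed_def\<close>)
    then show "v \<in> fixed (generate G K)" using vH by (simp add: fixed_def)
  qed
qed

text \<open>
  Unitary operators that preserve a subspace commute with its orthogonal projection.
\<close>

lemma rep_orth_proj:
  assumes S: "closed_linear S" "S \<subseteq> H" and g: "g \<in> carrier G"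
    and "\<And>s. s \<in> S \<Longrightarrow> \<pi> g s \<in> S" "\<And>s. s \<in> S \<Longrightarrow> \<pi> (inv g) s \<in> S" and v: "v \<in> H"
  shows "orth_proj S (\<pi> g v) = \<pi> g (orth_proj S v)"
proof (rule orth_proj_eqI)
  have p: "orth_proj S v \<in> S" by (rule orth_proj_in[OF S(1)])
  then have pH: "orth_proj S v \<in> H" using S(2) by blast
  show "\<pi> g (orth_proj S v) \<in> S" using p assms by blast
  fix s assume s: "s \<in> S"
  then have "inner (\<pi> g (v - orth_proj S v)) s = inner (v - orth_proj S v) (\<pi> (inv g) s)"
    using S(2) by (intro rep_inner_inv g subspace_diff[OF subspace_H_real v pH]) auto
  also have "\<dots> = 0"
    using s assms by (intro orth_proj_orth) auto
  finally show "inner (\<pi> g v - \<pi> g (orth_proj S v)) s = 0"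
    by (simp add: rep_diff[OF g v pH])
qed (use S in simp)

lemma commute_inv:
  assumes "a \<in> carrier G" "g \<in> carrier G" "a \<otimes> g = g \<otimes> a"
  shows "a \<otimes> inv g = inv g \<otimes> a"
proof -
  have "a \<otimes> inv g = inv g \<otimes> (g \<otimes> a) \<otimes> inv g"
    using assms(1,2) by (simp add: m_assoc[symmetric])
  also have "\<dots> = inv g \<otimes> (a \<otimes> g) \<otimes> inv g"
    by (simp add: assms(3))
  also have "\<dots> = inv g \<otimes> a"
    using assms(1,2) by (simp add: m_assoc)
  finally show ?thesis .
qed

lemma rep_fixed_commuting:
  assumes "K \<subseteq> carrier G" "g \<in> carrier G" "\<And>k. k \<in> K \<Longrightarrow> k \<otimes> g = g \<otimes> k" "v \<in> fixed K"
  shows "\<pi> g v \<in> fixed K"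
proof -
  have "\<pi> k (\<pi> g v) = \<pi> g v" if "k \<in> K" for k
  proof -
    have "\<pi> k (\<pi> g v) = \<pi> (g \<otimes> k) v"
      using assms that rep_mult[of k g v] by (auto simp: fixed_def)
    also have "\<dots> = \<pi> g v"
      using assms that rep_mult[of g k v] by (auto simp: fixed_def)
    finally show ?thesis .
  qed
  then show ?thesis using assms by (auto simp: fixed_def rep_closed)
qed

lemma orth_proj_fixed_commuting:
  assumes K: "K \<subseteq> carrier G" and L: "L \<subseteq> carrier G"
    and comm: "\<And>k l. k \<in> K \<Longrightarrow> l \<in> L \<Longrightarrow> k \<otimes> l = l \<otimes> k" and v: "v \<in> fixed L"
  shows "orth_proj (fixed K) v \<in> fixed L"
proof -
  have "\<pi> l (orth_proj (fixed K) v) = orth_proj (fixed K) v" if l: "l \<in> L" for l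
  proof -
    have lG: "l \<in> carrier G" using l L by auto
    have "orth_proj (fixed K) (\<pi> l v) = \<pi> l (orth_proj (fixed K) v)"
      using K lG l comm fixed_subset_H v
      by (intro rep_orth_proj closed_linear_fixed rep_fixed_commuting) (auto intro!: commute_inv)
    then show ?thesis using v l by (simp add: fixed_def)
  qed
  moreover have "orth_proj (fixed K) v \<in> H"
    using orth_proj_in[OF closed_linear_fixed[OF K]] by (rule fixed_subset_H)
  ultimately show ?thesis by (simp add: fixed_def)
qed

lemma orth_proj_fixed_absorb:
  assumes K: "K \<subseteq> carrier G" and k: "k \<in> K" and v: "v \<in> H"
  shows "orth_proj (fixed K) (\<pi> k v) = orth_proj (fixed K) v"
proof (rule orth_proj_eqI)
  have kG: "k \<in> carrier G" using k K by auto
  show "subspace (fixed K)" "orth_proj (fixed K) v \<in> fixed K"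
    using closed_linear_fixed[OF K] orth_proj_in by auto
  fix s assume s: "s \<in> fixed K"
  have "inner (\<pi> k v) s = inner (\<pi> k v) (\<pi> k s)"
    using s k by (simp add: fixed_def)
  also have "\<dots> = inner v s"
    by (rule rep_inner[OF kG v fixed_subset_H[OF s]])
  finally show "inner (\<pi> k v - orth_proj (fixed K) v) s = 0"
    by (simp add: inner_diff_left inner_orth_proj[OF closed_linear_fixed[OF K] s])
qed

text \<open>
  Let \<open>x\<close> be the component of \<open>v\<close> orthogonal to the fixed vectors; it is moved exactly as \<open>v\<close> is.
  If \<open>x\<close> were so long that every translate of \<open>x\<close> had inner product at least \<open>c > 0\<close> with \<open>x\<close>, the
  \<open>K\<close>-invariant closed convex set \<open>C\<close> of vectors having inner product at least \<open>c\<close> with all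
  translates of \<open>x\<close> would contain \<open>x\<close>. Its point of least norm would be fixed by \<open>K\<close> but not
  orthogonal to \<open>x\<close>.
\<close>

lemma distance_to_fixed_le:
  assumes K: "subgroup K G" and v: "v \<in> H" and small: "\<And>g. g \<in> K \<Longrightarrow> norm (\<pi> g v - v) \<le> \<epsilon>"
  shows "2 * (norm (v - orth_proj (fixed K) v))\<^sup>2 \<le> \<epsilon>\<^sup>2"
proof (rule ccontr)
  have KG: "K \<subseteq> carrier G" by (rule subgroup.subset[OF K])
  note cl = closed_linear_fixed[OF KG]
  define p x where "p = orth_proj (fixed K) v" and "x = v - p"
  assume "\<not> ?thesis"
  then have neg: "\<epsilon>\<^sup>2 < 2 * (norm x)\<^sup>2" by (simp add: x_def p_def)
  define c where "c = (norm x)\<^sup>2 - \<epsilon>\<^sup>2 / 2"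
  have c: "0 < c" using neg by (simp add: c_def)
  have p: "p \<in> fixed K" unfolding p_def by (rule orth_proj_in[OF cl])
  have pH: "p \<in> H" by (rule fixed_subset_H[OF p])
  have xH: "x \<in> H" unfolding x_def by (rule subspace_diff[OF subspace_H_real v pH])
  have move: "c \<le> inner (\<pi> g x) x" if g: "g \<in> K" for g
  proof -
    have gG: "g \<in> carrier G" using g KG by auto
    have "\<pi> g x - x = \<pi> g v - v"
      using p g by (simp add: x_def rep_diff[OF gG v pH] fixed_def)
    then have "(norm (\<pi> g x - x))\<^sup>2 \<le> \<epsilon>\<^sup>2"
      using small[OF g] by (intro power_mono) auto
    moreover have "(norm (\<pi> g x - x))\<^sup>2 = 2 * (norm x)\<^sup>2 - 2 * inner (\<pi> g x) x"
      by (simp add: power2_norm_eq_inner inner_diff_left inner_diff_right rep_inner[OF gG xH xH]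
          inner_commute)
    ultimately show ?thesis by (simp add: c_def)
  qed
  define C where "C = {y \<in> H. \<forall>g\<in>K. c \<le> inner (\<pi> g x) y}"
  have "C = H \<inter> (\<Inter>g\<in>K. {y. c \<le> inner (\<pi> g x) y})" by (auto simp: C_def)
  moreover have "closed \<dots>"
    by (intro closed_Int closed_H closed_INT ballI closed_Collect_le continuous_intros)
  ultimately have "closed C" by simp
  moreover have "convex C"
  proof (rule convexI)
    fix y z and a b :: real assume yz: "y \<in> C" "z \<in> C" and ab: "0 \<le> a" "0 \<le> b" "a + b = 1"
    have "c \<le> inner (\<pi> g x) (a *\<^sub>R y + b *\<^sub>R z)" if "g \<in> K" for g
    proof -
      have "a * c + b * c \<le> a * inner (\<pi> g x) y + b * inner (\<pi> g x) z"
        using yz that ab by (intro add_mono mult_left_mono) (auto simp: C_def)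
      then show ?thesis
        using ab(3) by (simp add: inner_add_right distrib_right[symmetric])
    qed
    then show "a *\<^sub>R y + b *\<^sub>R z \<in> C"
      using yz subspace_H_real by (auto simp: C_def intro: subspace_add subspace_scale)
  qed
  moreover have "x \<in> C" using xH move by (simp add: C_def)
  ultimately obtain m where m: "m \<in> C" "\<And>y. y \<in> C \<Longrightarrow> norm m \<le> norm y"
    using exists_minimal_norm[of C] by auto
  have mH: "m \<in> H" using m(1) by (simp add: C_def)
  have "\<pi> h m = m" if h: "h \<in> K" for h
  proof (rule minimal_norm_unique[OF \<open>convex C\<close> m])
    have hG: "h \<in> carrier G" using h KG by auto
    have "c \<le> inner (\<pi> g x) (\<pi> h m)" if g: "g \<in> K" for g
    proof -
      have gG: "g \<in> carrier G" using g KG by auto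
      have "inv h \<otimes> g \<in> K" using K g h by (simp add: subgroup.m_closed subgroup.m_inv_closed)
      then have "c \<le> inner (\<pi> (inv h \<otimes> g) x) m" using m(1) by (simp add: C_def)
      also have "\<dots> = inner (\<pi> (inv h) (\<pi> g x)) m"
        using gG hG xH by (simp add: rep_mult)
      also have "\<dots> = inner (\<pi> g x) (\<pi> h m)"
        using rep_inner_inv[of "inv h" "\<pi> g x" m] gG hG xH mH by (simp add: rep_closed)
      finally show ?thesis .
    qed
    then show "\<pi> h m \<in> C" using mH hG by (simp add: C_def rep_closed)
    show "norm (\<pi> h m) \<le> norm m" by (simp add: rep_norm[OF hG mH])
  qed
  then have "m \<in> fixed K" using mH by (simp add: fixed_def)
  then have "inner x m = 0" unfolding x_def p_def by (rule orth_proj_orth[OF cl])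
  moreover have "c \<le> inner (\<pi> \<one> x) m" using m(1) subgroup.one_closed[OF K] by (simp add: C_def)
  ultimately show False using c xH by (simp add: rep_one)
qed

end

section \<open>The angle between fixed spaces in a group of class two\<close>

lemma subspace_closure:
  fixes D :: "'v::real_normed_vector set"
  assumes D: "subspace D"
  shows "subspace (closure D)"
proof (rule subspaceI)
  show "0 \<in> closure D"
    using subspace_0[OF D] closure_subset by blast
  show "x + y \<in> closure D" if xy: "x \<in> closure D" "y \<in> closure D" for x y
  proof -
    obtain f g where "\<And>n. f n \<in> D" "f \<longlonglongrightarrow> x" "\<And>n. g n \<in> D" "g \<longlonglongrightarrow> y"
      using xy by (auto simp: closure_sequential)
    then show ?thesis
      unfolding closure_sequential
      by (intro exI[of _ "\<lambda>n. f n + g n"]) (auto intro: subspace_add[OF D] tendsto_add)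
  qed
  show "r *\<^sub>R x \<in> closure D" if x: "x \<in> closure D" for r x
  proof -
    obtain f where "\<And>n. f n \<in> D" "f \<longlonglongrightarrow> x"
      using x by (auto simp: closure_sequential)
    then show ?thesis
      unfolding closure_sequential
      by (intro exI[of _ "\<lambda>n. r *\<^sub>R f n"]) (auto intro: subspace_scale[OF D] tendsto_intros)
  qed
qed

text \<open>
  Angle bounds on two orthogonal summands combine: \<open>\<alpha>\<close>, \<open>\<beta>\<close> are the inner products and
  \<open>a\<close>, \<open>b\<close>, \<open>c\<close>, \<open>d\<close> the squared norms of the components.
\<close>

lemma angle_bound_orthogonal_sum:
  fixes \<alpha> \<beta> a b c d :: real
  assumes "2 * \<alpha>\<^sup>2 \<le> a * c" "2 * \<beta>\<^sup>2 \<le> b * d" and nonneg: "0 \<le> a" "0 \<le> b" "0 \<le> c" "0 \<le> d"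
  shows "2 * (\<alpha> + \<beta>)\<^sup>2 \<le> (a + b) * (c + d)"
proof -
  have "4 * ((2 * \<alpha>\<^sup>2) * (2 * \<beta>\<^sup>2)) \<le> 4 * ((a * c) * (b * d))"
    using mult_mono[OF assms(1,2)] nonneg by (simp add: mult_ac)
  moreover have "(4 * \<alpha> * \<beta>)\<^sup>2 = 4 * ((2 * \<alpha>\<^sup>2) * (2 * \<beta>\<^sup>2))"
    and "(a * d + b * c)\<^sup>2 = (a * d - b * c)\<^sup>2 + 4 * ((a * c) * (b * d))"
    by algebra+
  ultimately have "(4 * \<alpha> * \<beta>)\<^sup>2 \<le> (a * d + b * c)\<^sup>2"
    using zero_le_power2[of "a * d - b * c"] by linarith
  then have "4 * \<alpha> * \<beta> \<le> a * d + b * c"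
    by (rule power2_le_imp_le) (use nonneg in simp)
  then show ?thesis
    using assms(1,2) unfolding power2_sum distrib_left distrib_right by linarith
qed

text \<open>
  Two subgroups whose commutators are central in the group they generate.
\<close>

locale class_two_pair = unitary_representation +
  fixes A B :: "'a set"
  assumes A: "subgroup A G" and B: "subgroup B G"
    and central_A: "c \<in> commutator_subgroup G A B \<Longrightarrow> a \<in> A \<Longrightarrow> c \<otimes> a = a \<otimes> c"
    and central_B: "c \<in> commutator_subgroup G A B \<Longrightarrow> b \<in> B \<Longrightarrow> c \<otimes> b = b \<otimes> c"
begin

text \<open>
  The central elements \<open>[a, b]\<close> are collected for one \<open>b\<close> or for finitely many \<open>b\<close> at a time: an
  element \<open>b\<close> gives good control only on vectors orthogonal to \<open>fixed (Z {b})\<close>, and a vector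
  orthogonal to the fixed space of the whole commutator subgroup need not be orthogonal to any
  single one of these spaces.
\<close>

definition Z :: "'a set \<Rightarrow> 'a set"
  where "Z F = {a \<otimes> b \<otimes> inv a \<otimes> inv b | a b. a \<in> A \<and> b \<in> F}"

lemma A_carrier: "A \<subseteq> carrier G" and B_carrier: "B \<subseteq> carrier G"
  using subgroup.subset[OF A] subgroup.subset[OF B] by auto

lemma Z_carrier: "F \<subseteq> B \<Longrightarrow> Z F \<subseteq> carrier G"
  using A_carrier B_carrier by (fastforce simp: Z_def)

lemma commutator_subgroup_Z: "commutator_subgroup G A B = generate G (Z B)"
  by (simp add: commutator_subgroup_def Z_def)

lemma Z_subset: "F \<subseteq> B \<Longrightarrow> Z F \<subseteq> commutator_subgroup G A B"
  unfolding commutator_subgroup_Z by (auto simp: Z_def intro!: generate.incl)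

lemma fixed_commutator_subgroup: "fixed (commutator_subgroup G A B) = fixed (Z B)"
  unfolding commutator_subgroup_Z by (rule fixed_generate[OF Z_carrier]) simp

lemma Z_insert: "Z (insert b F) = Z {b} \<union> Z F"
  by (auto simp: Z_def)

lemma Z_commute_A: "F \<subseteq> B \<Longrightarrow> z \<in> Z F \<Longrightarrow> a \<in> A \<Longrightarrow> z \<otimes> a = a \<otimes> z"
  using Z_subset central_A by blast

lemma Z_commute_B: "F \<subseteq> B \<Longrightarrow> z \<in> Z F \<Longrightarrow> b \<in> B \<Longrightarrow> z \<otimes> b = b \<otimes> z"
  using Z_subset central_B by blast

lemma Z_commute_Z:
  assumes "F \<subseteq> B" "F' \<subseteq> B" "z \<in> Z F" "z' \<in> Z F'"
  shows "z \<otimes> z' = z' \<otimes> z"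
proof -
  obtain a b where z': "z' = a \<otimes> b \<otimes> inv a \<otimes> inv b" and a: "a \<in> A" and b: "b \<in> F'"
    using assms(4) by (auto simp: Z_def)
  have bB: "b \<in> B" using b assms(2) by auto
  have mem: "z \<in> carrier G" "a \<in> carrier G" "b \<in> carrier G"
    using a bB A_carrier B_carrier Z_carrier[OF assms(1)] assms(3) by auto
  have za: "z \<otimes> a = a \<otimes> z" and zb: "z \<otimes> b = b \<otimes> z"
    using Z_commute_A[OF assms(1,3) a] Z_commute_B[OF assms(1,3) bB] by auto
  have za': "z \<otimes> inv a = inv a \<otimes> z" and zb': "z \<otimes> inv b = inv b \<otimes> z"
    using commute_inv[OF mem(1) mem(2) za] commute_inv[OF mem(1) mem(3) zb] by auto
  have "z \<otimes> z' = (z \<otimes> a) \<otimes> b \<otimes> inv a \<otimes> inv b"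
    using mem by (simp add: z' m_assoc)
  also have "\<dots> = a \<otimes> (z \<otimes> b) \<otimes> inv a \<otimes> inv b"
    unfolding za using mem by (simp add: m_assoc)
  also have "\<dots> = a \<otimes> b \<otimes> (z \<otimes> inv a) \<otimes> inv b"
    unfolding zb using mem by (simp add: m_assoc)
  also have "\<dots> = a \<otimes> b \<otimes> inv a \<otimes> (z \<otimes> inv b)"
    unfolding za' using mem by (simp add: m_assoc)
  also have "\<dots> = z' \<otimes> z"
    unfolding zb' z' using mem by (simp add: m_assoc)
  finally show ?thesis .
qed

text \<open>
  The identity \<open>a b u = [a, b] b u\<close> for \<open>u\<close> fixed by \<open>A\<close> shows that the projection \<open>p\<close> of \<open>b u\<close> to the
  \<open>A\<close>-fixed vectors is fixed by every \<open>[a, b]\<close>. Hence \<open>u\<close> is orthogonal to \<open>p\<close>, thus to \<open>b u\<close>. Now \<open>u\<close>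
  and \<open>b u\<close> are two orthogonal vectors of the same length having the same inner product with the
  \<open>b\<close>-fixed vector \<open>w\<close>, and Cauchy-Schwarz for \<open>u + b u\<close> and \<open>w\<close> gains the factor 2.
\<close>

lemma angle_single:
  assumes b: "b \<in> B" and u: "u \<in> fixed A" and w: "w \<in> fixed B"
    and orth: "\<And>s. s \<in> fixed (Z {b}) \<Longrightarrow> inner u s = 0"
  shows "2 * (inner u w)\<^sup>2 \<le> (norm u)\<^sup>2 * (norm w)\<^sup>2"
proof -
  have bG: "b \<in> carrier G" using b B_carrier by auto
  have Zb: "Z {b} \<subseteq> carrier G" using b by (intro Z_carrier) auto
  have uH: "u \<in> H" and wH: "w \<in> H" using u w fixed_subset_H by auto
  have buH: "\<pi> b u \<in> H" by (rule rep_closed[OF bG uH])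
  define p where "p = orth_proj (fixed A) (\<pi> b u)"
  have pA: "p \<in> fixed A" unfolding p_def by (rule orth_proj_in[OF closed_linear_fixed[OF A_carrier]])
  have "\<pi> z p = p" if z: "z \<in> Z {b}" for z
  proof -
    obtain a where a: "a \<in> A" and za: "z = a \<otimes> b \<otimes> inv a \<otimes> inv b"
      using z by (auto simp: Z_def)
    have aG: "a \<in> carrier G" and zG: "z \<in> carrier G" using a A_carrier z Zb by auto
    have comm: "x \<otimes> z = z \<otimes> x" if "x \<in> A" for x
      using Z_commute_A[of "{b}" z x] b z that by simp
    have "\<pi> z (\<pi> b u) = \<pi> (a \<otimes> b \<otimes> inv a) u"
      using aG bG zG uH rep_mult[of z b u] by (simp add: za m_assoc)
    also have "\<dots> = \<pi> a (\<pi> b (\<pi> (inv a) u))"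
      using aG bG uH by (simp add: rep_mult rep_closed)
    also have "\<pi> (inv a) u = u"
      using u subgroup.m_inv_closed[OF A a] by (simp add: fixed_def)
    finally have zbu: "\<pi> z (\<pi> b u) = \<pi> a (\<pi> b u)" .
    have "\<pi> z p = orth_proj (fixed A) (\<pi> z (\<pi> b u))"
      unfolding p_def using A_carrier zG buH comm fixed_subset_H
      by (intro rep_orth_proj[symmetric] closed_linear_fixed rep_fixed_commuting)
        (auto intro!: commute_inv)
    also have "\<dots> = p"
      unfolding zbu p_def by (rule orth_proj_fixed_absorb[OF A_carrier a buH])
    finally show ?thesis .
  qed
  then have "p \<in> fixed (Z {b})"
    using fixed_subset_H[OF pA] by (simp add: fixed_def)
  then have "inner u p = 0" by (rule orth)
  then have "inner (\<pi> b u) u = 0"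
    using inner_orth_proj[OF closed_linear_fixed[OF A_carrier] u, of "\<pi> b u"]
    by (simp add: p_def inner_commute)
  then have "inner (u + \<pi> b u) (u + \<pi> b u) = 2 * (norm u)\<^sup>2"
    by (simp add: inner_add_left inner_add_right inner_commute rep_inner[OF bG uH uH]
        power2_norm_eq_inner)
  moreover have "inner (u + \<pi> b u) w = 2 * inner u w"
    using rep_inner[OF bG uH wH] w b by (simp add: fixed_def inner_add_left)
  ultimately have "(2 * inner u w)\<^sup>2 \<le> 2 * (norm u)\<^sup>2 * (norm w)\<^sup>2"
    using Cauchy_Schwarz_ineq[of "u + \<pi> b u" w] by (simp add: power2_norm_eq_inner)
  then show ?thesis by (simp add: power_mult_distrib)
qed

text \<open>
  Split \<open>u\<close> and \<open>w\<close> along \<open>fixed (Z {b})\<close>. Since the commutators are central, both components stay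
  fixed by \<open>A\<close> or \<open>B\<close>; the one orthogonal to \<open>fixed (Z {b})\<close> is controlled by \<open>b\<close>, the other one by
  the remaining elements.
\<close>

lemma angle_finite:
  assumes "finite F" "F \<subseteq> B" and u: "u \<in> fixed A" and w: "w \<in> fixed B"
    and "\<And>s. s \<in> fixed (Z F) \<Longrightarrow> inner u s = 0"
  shows "2 * (inner u w)\<^sup>2 \<le> (norm u)\<^sup>2 * (norm w)\<^sup>2"
  using assms
proof (induction F arbitrary: u w rule: finite_induct)
  case empty
  have "u \<in> fixed (Z {})"
    using fixed_subset_H[OF empty.prems(2)] by (simp add: Z_def fixed_def)
  then have "inner u u = 0" by (rule empty.prems(4))
  then show ?case by simp
next
  case (insert b F)
  have b: "b \<in> B" "{b} \<subseteq> B" and F: "F \<subseteq> B" using insert.prems(1) by auto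
  note cl = closed_linear_fixed[OF Z_carrier[OF b(2)]]
  let ?q = "orth_proj (fixed (Z {b}))"
  have qA: "?q x \<in> fixed A" if "x \<in> fixed A" for x
    using that by (intro orth_proj_fixed_commuting Z_carrier b A_carrier) (auto intro: Z_commute_A[OF b(2)])
  have qB: "?q x \<in> fixed B" if "x \<in> fixed B" for x
    using that by (intro orth_proj_fixed_commuting Z_carrier b B_carrier) (auto intro: Z_commute_B[OF b(2)])
  have qF: "?q s \<in> fixed (Z F)" if "s \<in> fixed (Z F)" for s
    using that by (intro orth_proj_fixed_commuting Z_carrier b F) (auto intro: Z_commute_Z[OF b(2) F])
  have sub: "subspace (fixed A)" "subspace (fixed B)"
    using closed_linear_fixed A_carrier B_carrier by auto
  have split: "inner x y = inner (x - ?q x) (y - ?q y) + inner (?q x) (?q y)" for x y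
    using inner_orth_proj[OF cl orth_proj_in[OF cl], of x y]
      inner_orth_proj[OF cl orth_proj_in[OF cl], of y x]
    by (simp add: inner_diff_left inner_diff_right inner_commute)
  have "2 * (inner (u - ?q u) (w - ?q w))\<^sup>2 \<le> (norm (u - ?q u))\<^sup>2 * (norm (w - ?q w))\<^sup>2"
    using insert.prems(2,3) qA qB sub orth_proj_orth[OF cl]
    by (intro angle_single[OF b(1)]) (auto intro: subspace_diff)
  moreover have "2 * (inner (?q u) (?q w))\<^sup>2 \<le> (norm (?q u))\<^sup>2 * (norm (?q w))\<^sup>2"
  proof (rule insert.IH[OF F qA[OF insert.prems(2)] qB[OF insert.prems(3)]])
    fix s assume s: "s \<in> fixed (Z F)"
    have "inner (?q u) s = inner (?q u) (?q s)"
      using inner_orth_proj[OF cl orth_proj_in[OF cl], of s u] by (simp add: inner_commute)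
    also have "\<dots> = inner u (?q s)"
      by (rule inner_orth_proj[OF cl orth_proj_in[OF cl]])
    also have "\<dots> = 0"
      using qF[OF s] orth_proj_in[OF cl, of s]
      by (intro insert.prems(4)) (simp add: Z_insert[of b F] fixed_Un)
    finally show "inner (?q u) s = 0" .
  qed
  ultimately have "2 * (inner (u - ?q u) (w - ?q w) + inner (?q u) (?q w))\<^sup>2
      \<le> ((norm (u - ?q u))\<^sup>2 + (norm (?q u))\<^sup>2) * ((norm (w - ?q w))\<^sup>2 + (norm (?q w))\<^sup>2)"
    by (rule angle_bound_orthogonal_sum) auto
  then show ?case
    unfolding split[symmetric] norm_diff_orth_proj[OF cl] by simp
qed

text \<open>
  By \<open>angle_finite\<close> the bound holds on the space \<open>D\<close> of \<open>A\<close>-fixed vectors that are orthogonal to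
  \<open>fixed (Z F)\<close> for some finite \<open>F\<close>, hence on its closure. The closure of \<open>D\<close> contains \<open>u\<close>: the component
  \<open>r\<close> of \<open>u\<close> orthogonal to \<open>D\<close> is fixed by \<open>Z {b}\<close> for each \<open>b\<close>, because its part orthogonal to
  \<open>fixed (Z {b})\<close> belongs to \<open>D\<close>. So \<open>r\<close> is fixed by the commutator subgroup and orthogonal to \<open>u\<close>,
  whence \<open>r = 0\<close>.
\<close>

theorem angle_class_two:
  assumes u: "u \<in> fixed A" and w: "w \<in> fixed B"
    and orth: "\<And>s. s \<in> fixed (commutator_subgroup G A B) \<Longrightarrow> inner u s = 0"
  shows "2 * (inner u w)\<^sup>2 \<le> (norm u)\<^sup>2 * (norm w)\<^sup>2"
proof -
  define D where
    "D = {x \<in> fixed A. \<exists>F. finite F \<and> F \<subseteq> B \<and> (\<forall>s\<in>fixed (Z F). inner x s = 0)}"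
  note clA = closed_linear_fixed[OF A_carrier]
  have "subspace D"
  proof (rule subspaceI)
    show "0 \<in> D" using clA by (auto simp: D_def subspace_0)
    show "r *\<^sub>R x \<in> D" if "x \<in> D" for r x
      using that clA by (auto simp: D_def subspace_scale)
    show "x + y \<in> D" if x: "x \<in> D" and y: "y \<in> D" for x y
    proof -
      obtain F F' where F: "finite F" "F \<subseteq> B" "\<And>s. s \<in> fixed (Z F) \<Longrightarrow> inner x s = 0"
        and F': "finite F'" "F' \<subseteq> B" "\<And>s. s \<in> fixed (Z F') \<Longrightarrow> inner y s = 0"
        using x y by (auto simp: D_def)
      have "fixed (Z (F \<union> F')) \<subseteq> fixed (Z F) \<inter> fixed (Z F')"
        by (intro Int_greatest fixed_antimono) (auto simp: Z_def)
      then have "inner (x + y) s = 0" if "s \<in> fixed (Z (F \<union> F'))" for s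
        using F(3)[of s] F'(3)[of s] that unfolding inner_add_left by (simp add: subset_iff)
      then show ?thesis
        using x y F F' clA unfolding D_def
        by (auto intro!: subspace_add exI[of _ "F \<union> F'"])
    qed
  qed
  then have clD: "closed_linear (closure D)"
    by (simp add: subspace_closure)
  have DA: "closure D \<subseteq> fixed A"
    using clA by (intro closure_minimal) (auto simp: D_def)
  define r where "r = u - orth_proj (closure D) u"
  have rA: "r \<in> fixed A"
    unfolding r_def using u DA orth_proj_in[OF clD] clA by (blast intro: subspace_diff)
  have r_orth: "inner r x = 0" if "x \<in> closure D" for x
    unfolding r_def by (rule orth_proj_orth[OF clD that])
  have "r \<in> fixed (Z {b})" if b: "b \<in> B" for b
  proof -
    have bB: "{b} \<subseteq> B" using b by auto
    note cl = closed_linear_fixed[OF Z_carrier[OF bB]]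
    define q where "q = orth_proj (fixed (Z {b})) r"
    have "q \<in> fixed A"
      unfolding q_def using rA
      by (intro orth_proj_fixed_commuting Z_carrier bB A_carrier) (auto intro: Z_commute_A[OF bB])
    then have "r - q \<in> fixed A"
      using rA clA by (blast intro: subspace_diff)
    moreover have "\<forall>s\<in>fixed (Z {b}). inner (r - q) s = 0"
      unfolding q_def using orth_proj_orth[OF cl] by blast
    ultimately have "r - q \<in> D"
      unfolding D_def using bB by (auto intro!: exI[of _ "{b}"])
    then have "inner r (r - q) = 0"
      using closure_subset by (blast intro: r_orth)
    moreover have "inner q (r - q) = 0"
      using orth_proj_orth[OF cl orth_proj_in[OF cl], of r r] by (simp add: q_def inner_commute)
    ultimately have "inner (r - q) (r - q) = 0"
      by (simp add: inner_diff_left)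
    then have "r = q" by simp
    then show ?thesis using orth_proj_in[OF cl, of r] by (simp add: q_def)
  qed
  then have "r \<in> fixed (Z B)"
    using fixed_subset_H[OF rA] by (auto simp: fixed_def Z_def)
  then have "inner u r = 0"
    by (intro orth) (simp add: fixed_commutator_subgroup)
  moreover have "inner r (orth_proj (closure D) u) = 0"
    by (rule r_orth[OF orth_proj_in[OF clD]])
  ultimately have "inner r r = 0"
    by (simp add: r_def inner_diff_left inner_commute)
  then have "u \<in> closure D"
    using orth_proj_in[OF clD, of u] by (simp add: r_def)
  moreover have "closure D \<subseteq> {x. 2 * (inner x w)\<^sup>2 \<le> (norm x)\<^sup>2 * (norm w)\<^sup>2}"
  proof (rule closure_minimal)
    show "D \<subseteq> {x. 2 * (inner x w)\<^sup>2 \<le> (norm x)\<^sup>2 * (norm w)\<^sup>2}"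
      using angle_finite[OF _ _ _ w] by (auto simp: D_def)
    show "closed {x. 2 * (inner x w)\<^sup>2 \<le> (norm x)\<^sup>2 * (norm w)\<^sup>2}"
      by (intro closed_Collect_le continuous_intros)
  qed
  ultimately show ?thesis by blast
qed

end

section \<open>Hexagons of subgroups and their Kazhdan constants\<close>

text \<open>
  Going around the hexagon, the order in which the two neighbours of \<open>R i\<close> appear in the
  commutator formula alternates between consecutive roots; both orders are admitted at every place
  in order to keep the axioms invariant under rotation.
\<close>

locale root_hexagon = unitary_representation +
  fixes R :: "int \<Rightarrow> 'a set"
  assumes subgroup_R: "subgroup (R i) G"
    and periodic_R: "R (i + 6) = R i"
    and commute_R: "x \<in> R i \<Longrightarrow> y \<in> R (i + 1) \<Longrightarrow> x \<otimes> y = y \<otimes> x"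
    and commutator_R: "R i = commutator_subgroup G (R (i - 1)) (R (i + 1))
      \<or> R i = commutator_subgroup G (R (i + 1)) (R (i - 1))"
begin

lemma R_carrier: "R i \<subseteq> carrier G"
  by (rule subgroup.subset[OF subgroup_R])

lemma commute_R_prev: "x \<in> R i \<Longrightarrow> y \<in> R (i - 1) \<Longrightarrow> x \<otimes> y = y \<otimes> x"
  using commute_R[of y "i - 1" x] by simp

lemma commutators_in_R:
  assumes a: "a \<in> R (i - 1)" and b: "b \<in> R (i + 1)"
  shows "a \<otimes> b \<otimes> inv a \<otimes> inv b \<in> R i"
  using commutator_R[of i]
proof
  assume "R i = commutator_subgroup G (R (i - 1)) (R (i + 1))"
  then show ?thesis using a b by (auto simp: commutator_subgroup_def intro!: generate.incl)
next
  assume *: "R i = commutator_subgroup G (R (i + 1)) (R (i - 1))"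
  have "b \<otimes> a \<otimes> inv b \<otimes> inv a \<in> R i"
    using a b unfolding * by (auto simp: commutator_subgroup_def intro!: generate.incl)
  then have "inv (b \<otimes> a \<otimes> inv b \<otimes> inv a) \<in> R i"
    by (rule subgroup.m_inv_closed[OF subgroup_R])
  moreover have "a \<in> carrier G" "b \<in> carrier G" using a b R_carrier by auto
  ultimately show ?thesis by (simp add: inv_mult_group m_assoc)
qed

lemma fixed_R_meet: "fixed (R (i - 1)) \<inter> fixed (R (i + 1)) \<subseteq> fixed (R i)"
proof -
  have sub: "commutator_subgroup G (R j) (R k) \<subseteq> generate G (R j \<union> R k)" for j k
    unfolding commutator_subgroup_def
  proof (rule generate_subgroup_incl)
    have RG: "R j \<union> R k \<subseteq> carrier G" using R_carrier by auto
    show "subgroup (generate G (R j \<union> R k)) G"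
      by (rule generate_is_subgroup[OF RG])
    show "{a \<otimes> b \<otimes> inv a \<otimes> inv b |a b. a \<in> R j \<and> b \<in> R k} \<subseteq> generate G (R j \<union> R k)"
    proof clarify
      fix a b assume "a \<in> R j" "b \<in> R k"
      then have "a \<in> generate G (R j \<union> R k)" "b \<in> generate G (R j \<union> R k)"
        by (auto intro: generate.incl)
      then show "a \<otimes> b \<otimes> inv a \<otimes> inv b \<in> generate G (R j \<union> R k)"
        by (intro generate.eng generate_m_inv_closed[OF RG])
    qed
  qed
  have "R i \<subseteq> generate G (R (i - 1) \<union> R (i + 1))"
    using commutator_R[of i] sub[of "i - 1" "i + 1"] sub[of "i + 1" "i - 1"] by (auto simp: Un_commute)
  then have "fixed (generate G (R (i - 1) \<union> R (i + 1))) \<subseteq> fixed (R i)"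
    by (rule fixed_antimono)
  then show ?thesis
    using R_carrier by (simp add: fixed_generate fixed_Un)
qed

lemma fixed_R_angle:
  assumes u: "u \<in> fixed (R (i - 1))" and w: "w \<in> fixed (R (i + 1))"
    and orth_u: "\<And>s. s \<in> fixed (R i) \<Longrightarrow> inner u s = 0"
    and orth_w: "\<And>s. s \<in> fixed (R i) \<Longrightarrow> inner w s = 0"
  shows "2 * (inner u w)\<^sup>2 \<le> (norm u)\<^sup>2 * (norm w)\<^sup>2"
  using commutator_R[of i]
proof
  assume *: "R i = commutator_subgroup G (R (i - 1)) (R (i + 1))"
  interpret class_two_pair G H \<pi> "R (i - 1)" "R (i + 1)"
    by (intro class_two_pair.intro class_two_pair_axioms.intro unitary_representation_axioms subgroup_R)
      (auto simp: *[symmetric] intro: commute_R commute_R_prev)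
  show ?thesis
    using u w orth_u by (intro angle_class_two) (simp_all add: *[symmetric])
next
  assume *: "R i = commutator_subgroup G (R (i + 1)) (R (i - 1))"
  interpret class_two_pair G H \<pi> "R (i + 1)" "R (i - 1)"
    by (intro class_two_pair.intro class_two_pair_axioms.intro unitary_representation_axioms subgroup_R)
      (auto simp: *[symmetric] intro: commute_R commute_R_prev)
  show ?thesis
    using angle_class_two[OF w u] orth_w by (simp add: *[symmetric] inner_commute mult.commute)
qed

text \<open>
  On the fixed space of the central subgroup \<open>R i\<close>, the subgroups \<open>R j\<close> and \<open>R k\<close> act by commuting
  operators. For vectors in that space, projecting to \<open>fixed (R j)\<close> is the same as projecting to
  \<open>fixed (R j) \<inter> fixed (R i)\<close>, and the latter space is preserved by \<open>R k\<close>.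
\<close>

lemma orth_proj_fixed_class_two:
  assumes jk: "\<And>a b. a \<in> R j \<Longrightarrow> b \<in> R k \<Longrightarrow> a \<otimes> b \<otimes> inv a \<otimes> inv b \<in> R i"
    and ij: "\<And>x y. x \<in> R i \<Longrightarrow> y \<in> R j \<Longrightarrow> x \<otimes> y = y \<otimes> x"
    and ik: "\<And>x y. x \<in> R i \<Longrightarrow> y \<in> R k \<Longrightarrow> x \<otimes> y = y \<otimes> x"
    and v: "v \<in> fixed (R i)" "v \<in> fixed (R k)"
  shows "orth_proj (fixed (R j)) v \<in> fixed (R k)"
proof -
  note cl = closed_linear_fixed[OF R_carrier]
  let ?S = "fixed (R j) \<inter> fixed (R i)"
  have clS: "closed_linear ?S" using cl by (auto intro: subspace_inter)
  have SH: "?S \<subseteq> H" by (auto simp: fixed_def)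
  have vH: "v \<in> H" by (rule fixed_subset_H[OF v(1)])
  have "orth_proj (fixed (R j)) v = orth_proj (fixed (R j)) (orth_proj (fixed (R i)) v)"
    using cl v(1) by (simp add: orth_proj_self)
  also have "\<dots> = orth_proj ?S v"
    using ij R_carrier by (intro orth_proj_orth_proj cl orth_proj_fixed_commuting) auto
  finally have eq: "orth_proj (fixed (R j)) v = orth_proj ?S v" .
  have pres: "\<pi> b s \<in> ?S" if b: "b \<in> R k" and s: "s \<in> ?S" for b s
  proof -
    have bG: "b \<in> carrier G" and sH: "s \<in> H" using b R_carrier s SH by auto
    have bsi: "\<pi> b s \<in> fixed (R i)"
      using s b ik R_carrier bG by (intro rep_fixed_commuting) auto
    have "\<pi> a (\<pi> b s) = \<pi> b s" if a: "a \<in> R j" for a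
    proof -
      have aG: "a \<in> carrier G" using a R_carrier by auto
      let ?c = "a \<otimes> b \<otimes> inv a \<otimes> inv b"
      have c: "?c \<in> R i" by (rule jk[OF a b])
      have "\<pi> a (\<pi> b s) = \<pi> (?c \<otimes> b \<otimes> a) s"
        using aG bG sH rep_mult[of a b s] by (simp add: m_assoc)
      also have "\<dots> = \<pi> ?c (\<pi> b (\<pi> a s))"
        using aG bG sH by (simp add: rep_mult rep_closed del: m_assoc)
      also have "\<dots> = \<pi> b s"
        using s a bsi c by (auto simp: fixed_def)
      finally show ?thesis .
    qed
    then show ?thesis using bsi by (auto simp: fixed_def)
  qed
  have "\<pi> b (orth_proj ?S v) = orth_proj ?S v" if b: "b \<in> R k" for b
  proof -
    have "orth_proj ?S (\<pi> b v) = \<pi> b (orth_proj ?S v)"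
      using b R_carrier pres subgroup.m_inv_closed[OF subgroup_R b]
      by (intro rep_orth_proj clS SH vH) auto
    then show ?thesis using v(2) b by (simp add: fixed_def)
  qed
  then show ?thesis
    unfolding eq using orth_proj_in[OF clS, of v] SH by (auto simp: fixed_def)
qed

sublocale subspace_hexagon "\<lambda>i. fixed (R i)"
proof
  fix i
  show "closed_linear (fixed (R i))" by (rule closed_linear_fixed[OF R_carrier])
  show "fixed (R (i + 6)) = fixed (R i)" by (simp add: periodic_R)
  show "orth_proj (fixed (R i)) v \<in> fixed (R (i + 1))" if "v \<in> fixed (R (i + 1))" for v
    using that by (intro orth_proj_fixed_commuting R_carrier) (auto intro: commute_R)
  show "orth_proj (fixed (R i)) v \<in> fixed (R (i - 1))" if "v \<in> fixed (R (i - 1))" for v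
    using that by (intro orth_proj_fixed_commuting R_carrier) (auto intro: commute_R_prev)
  show "fixed (R (i - 1)) \<inter> fixed (R (i + 1)) \<subseteq> fixed (R i)" by (rule fixed_R_meet)
  show "orth_proj (fixed (R (i - 1))) v \<in> fixed (R (i + 1))"
    if "v \<in> fixed (R i)" "v \<in> fixed (R (i + 1))" for v
    by (rule orth_proj_fixed_class_two[OF commutators_in_R _ _ that])
      (auto intro: commute_R commute_R_prev)
  show "orth_proj (fixed (R (i + 1))) v \<in> fixed (R (i - 1))"
    if "v \<in> fixed (R i)" "v \<in> fixed (R (i - 1))" for v
  proof (rule orth_proj_fixed_class_two[OF _ _ _ that])
    fix a b assume a: "a \<in> R (i + 1)" and b: "b \<in> R (i - 1)"
    have "inv (b \<otimes> a \<otimes> inv b \<otimes> inv a) \<in> R i"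
      by (rule subgroup.m_inv_closed[OF subgroup_R commutators_in_R[OF b a]])
    moreover have "a \<in> carrier G" "b \<in> carrier G" using a b R_carrier by auto
    ultimately show "a \<otimes> b \<otimes> inv a \<otimes> inv b \<in> R i" by (simp add: inv_mult_group m_assoc)
  qed (auto intro: commute_R commute_R_prev)
  show "2 * (inner u w)\<^sup>2 \<le> (norm u)\<^sup>2 * (norm w)\<^sup>2"
    if "u \<in> fixed (R (i - 1))" "w \<in> fixed (R (i + 1))"
      "\<And>s. s \<in> fixed (R i) \<Longrightarrow> inner u s = 0" "\<And>s. s \<in> fixed (R i) \<Longrightarrow> inner w s = 0" for u w
    using that by (rule fixed_R_angle)
qed

end
context root_hexagon
begin

text \<open>
  \<open>V 1\<close> and \<open>V 4\<close> belong to opposite positions of the hexagon, and the six root subgroups that fix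
  one or the other generate the group.
\<close>

lemma distance_to_opposite_spaces:
  assumes gen: "generate G (\<Union>i\<in>{0..5}. R i) = carrier G" and inv: "no_invariant_vectors G H \<pi>"
    and "v \<noteq> 0" and r: "norm (v - P 1 v) \<le> r * norm v" "norm (v - P 4 v) \<le> r * norm v"
  shows "1 \<le> 9 * r\<^sup>2"
proof -
  have "(\<Inter>i\<in>{0..5}. fixed (R i)) \<subseteq> {0}"
  proof
    fix x assume x: "x \<in> (\<Inter>i\<in>{0..5}. fixed (R i))"
    then have "x \<in> fixed (R 0)" by simp
    then have xH: "x \<in> H" by (rule fixed_subset_H)
    then have "x \<in> fixed (\<Union>i\<in>{0..5}. R i)"
      using x by (auto simp: fixed_def)
    then have "x \<in> fixed (carrier G)"
      using R_carrier gen fixed_generate[of "\<Union>i\<in>{0..5}. R i"] by auto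
    then show "x \<in> {0}"
      using inv xH by (auto simp: no_invariant_vectors_def fixed_def)
  qed
  then have "2 * (norm (P 4 z))\<^sup>2 \<le> (norm z)\<^sup>2" if "z \<in> V 1" for z
    using that by (rule opposite_angle)
  then show ?thesis
    using r \<open>v \<noteq> 0\<close> by (rule distance_to_both_subspaces[OF closed_linear_V closed_linear_V])
qed

lemma distance_to_fixed_le_relative:
  assumes K: "subgroup K G" and v: "v \<in> H" and "0 \<le> \<epsilon>"
    and small: "\<And>g. g \<in> K \<Longrightarrow> norm (\<pi> g v - v) \<le> \<epsilon> * norm v"
  shows "norm (v - orth_proj (fixed K) v) \<le> \<epsilon> / sqrt 2 * norm v"
proof (rule power2_le_imp_le)
  have "2 * (norm (v - orth_proj (fixed K) v))\<^sup>2 \<le> (\<epsilon> * norm v)\<^sup>2"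
    by (rule distance_to_fixed_le[OF K v small])
  then show "(norm (v - orth_proj (fixed K) v))\<^sup>2 \<le> (\<epsilon> / sqrt 2 * norm v)\<^sup>2"
    by (simp add: power_mult_distrib power_divide)
qed (use \<open>0 \<le> \<epsilon>\<close> in simp)

lemma displacement_of_triples:
  assumes gen: "generate G (\<Union>i\<in>{0..5}. R i) = carrier G" and inv: "no_invariant_vectors G H \<pi>"
    and v: "v \<in> H" "v \<noteq> 0" and "0 < \<epsilon>"
    and small: "\<And>i g. i \<in> {1, 4} \<Longrightarrow> g \<in> generate G (R (i - 1) \<union> R (i + 1))
      \<Longrightarrow> norm (\<pi> g v - v) \<le> \<epsilon> * norm v"
  shows "3 / 8 \<le> \<epsilon>"
proof (rule ccontr)
  assume "\<not> ?thesis"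
  then have "\<epsilon>\<^sup>2 < (3 / 8)\<^sup>2"
    using \<open>0 < \<epsilon>\<close> by (intro power_strict_mono) auto
  have V_fixed: "V i = fixed (generate G (R (i - 1) \<union> R (i + 1)))" for i
    using R_carrier by (simp add: V_def fixed_generate fixed_Un)
  have "norm (v - P i v) \<le> \<epsilon> / sqrt 2 * norm v" if "i \<in> {1, 4}" for i
    unfolding V_fixed using R_carrier \<open>0 < \<epsilon>\<close> small[OF that]
    by (intro distance_to_fixed_le_relative generate_is_subgroup v) auto
  then have "1 \<le> 9 * (\<epsilon> / sqrt 2)\<^sup>2"
    using distance_to_opposite_spaces[OF gen inv v(2)] by simp
  then show False
    using \<open>\<epsilon>\<^sup>2 < (3 / 8)\<^sup>2\<close> by (simp add: power_divide)
qed

lemma displacement_of_roots: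
  assumes gen: "generate G (\<Union>i\<in>{0..5}. R i) = carrier G" and inv: "no_invariant_vectors G H \<pi>"
    and v: "v \<in> H" "v \<noteq> 0" and "0 < \<epsilon>"
    and small: "\<And>i g. i \<in> {0..5} \<Longrightarrow> g \<in> R i \<Longrightarrow> norm (\<pi> g v - v) \<le> \<epsilon> * norm v"
  shows "1 / 8 \<le> \<epsilon>"
proof (rule ccontr)
  assume "\<not> ?thesis"
  then have "\<epsilon>\<^sup>2 < (1 / 8)\<^sup>2"
    using \<open>0 < \<epsilon>\<close> by (intro power_strict_mono) auto
  have near: "norm (v - Q i v) \<le> \<epsilon> / sqrt 2 * norm v" if "i \<in> {0..5}" for i
    using \<open>0 < \<epsilon>\<close> small[OF that] by (intro distance_to_fixed_le_relative subgroup_R v) auto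
  have "norm (v - P i v) \<le> 3 * \<epsilon> / sqrt 2 * norm v" if "i \<in> {1, 4}" for i
  proof -
    have "i - 1 \<in> {0..5}" "i \<in> {0..5}" "i + 1 \<in> {0..5}"
      using that by auto
    then have "norm (v - P i v) \<le> 3 * (\<epsilon> / sqrt 2 * norm v)"
      using norm_diff_P_le[of v i] near[of "i - 1"] near[of i] near[of "i + 1"] by linarith
    then show ?thesis by simp
  qed
  then have "1 \<le> 9 * (3 * \<epsilon> / sqrt 2)\<^sup>2"
    using distance_to_opposite_spaces[OF gen inv v(2)] by simp
  then show False
    using \<open>\<epsilon>\<^sup>2 < (1 / 8)\<^sup>2\<close> by (simp add: power_divide power_mult_distrib)
qed

end

section \<open>The hexagon of an \<open>A\<^sub>2\<close>-system\<close>

definition root_subgroup :: "(nat \<Rightarrow> nat \<Rightarrow> 'g set) \<Rightarrow> int \<Rightarrow> 'g set"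
  where "root_subgroup X i =
    (let r = i mod 6 in
     if r = 0 then X 1 2 else if r = 1 then X 1 3 else if r = 2 then X 2 3
     else if r = 3 then X 2 1 else if r = 4 then X 3 1 else X 3 2)"

lemma hexagon_cases:
  fixes i :: int
  obtains "i mod 6 = 0" "(i + 1) mod 6 = 1" "(i - 1) mod 6 = 5"
  | "i mod 6 = 1" "(i + 1) mod 6 = 2" "(i - 1) mod 6 = 0"
  | "i mod 6 = 2" "(i + 1) mod 6 = 3" "(i - 1) mod 6 = 1"
  | "i mod 6 = 3" "(i + 1) mod 6 = 4" "(i - 1) mod 6 = 2"
  | "i mod 6 = 4" "(i + 1) mod 6 = 5" "(i - 1) mod 6 = 3"
  | "i mod 6 = 5" "(i + 1) mod 6 = 0" "(i - 1) mod 6 = 4"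
proof -
  have "0 \<le> i mod 6" "i mod 6 < 6" by simp_all
  then consider "i mod 6 = 0" | "i mod 6 = 1" | "i mod 6 = 2" | "i mod 6 = 3" | "i mod 6 = 4" | "i mod 6 = 5"
    by linarith
  moreover have "(i + 1) mod 6 = (i mod 6 + 1) mod 6" "(i - 1) mod 6 = (i mod 6 - 1) mod 6"
    by (simp_all only: mod_add_left_eq mod_diff_left_eq)
  ultimately show thesis
    by cases (simp_all add: that)
qed

lemma permutations_of_three:
  "{1, 2, 3} = {1, 2, 3::nat}" "{1, 3, 2} = {1, 2, 3::nat}" "{2, 1, 3} = {1, 2, 3::nat}"
  "{2, 3, 1} = {1, 2, 3::nat}" "{3, 1, 2} = {1, 2, 3::nat}" "{3, 2, 1} = {1, 2, 3::nat}"
  by auto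

lemma root_subgroup_values:
  "root_subgroup X 0 = X 1 2" "root_subgroup X 1 = X 1 3" "root_subgroup X 2 = X 2 3"
  "root_subgroup X 3 = X 2 1" "root_subgroup X 4 = X 3 1" "root_subgroup X 5 = X 3 2"
  by (simp_all add: root_subgroup_def)

text \<open>
  The cyclic order alternates between changing the second and the first index of the root, so
  neighbours share a row or a column and commute, while roots two steps apart are of the form
  \<open>(i, j)\<close>, \<open>(j, k)\<close> in one of the two orders, with \<open>(i, k)\<close> in between.
\<close>

lemma root_hexagon_A2:
  assumes A2: "A2_system G X" and rep: "unitary_representation G H \<pi>"
  shows "root_hexagon G H \<pi> (root_subgroup X)"
proof (intro root_hexagon.intro root_hexagon_axioms.intro rep)
  fix i
  interpret A2_system G X by (rule A2)
  let ?R = "root_subgroup X"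
  show "subgroup (?R i) G"
    by (cases i rule: hexagon_cases) (simp_all add: root_subgroup_def subgroup_X)
  show "?R (i + 6) = ?R i"
    by (simp add: root_subgroup_def)
  show "x \<otimes>\<^bsub>G\<^esub> y = y \<otimes>\<^bsub>G\<^esub> x" if "x \<in> ?R i" "y \<in> ?R (i + 1)" for x y
  proof (cases i rule: hexagon_cases)
    case 1
    then have "x \<in> X 1 2" "y \<in> X 1 3" using that by (simp_all add: root_subgroup_def)
    then show ?thesis by (rule commute_row[OF permutations_of_three(1)])
  next
    case 2
    then have "x \<in> X 1 3" "y \<in> X 2 3" using that by (simp_all add: root_subgroup_def)
    then show ?thesis by (rule commute_col[OF permutations_of_three(5)])
  next
    case 3
    then have "x \<in> X 2 3" "y \<in> X 2 1" using that by (simp_all add: root_subgroup_def)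
    then show ?thesis by (rule commute_row[OF permutations_of_three(4)])
  next
    case 4
    then have "x \<in> X 2 1" "y \<in> X 3 1" using that by (simp_all add: root_subgroup_def)
    then show ?thesis by (rule commute_col[OF permutations_of_three(1)])
  next
    case 5
    then have "x \<in> X 3 1" "y \<in> X 3 2" using that by (simp_all add: root_subgroup_def)
    then show ?thesis by (rule commute_row[OF permutations_of_three(5)])
  next
    case 6
    then have "x \<in> X 3 2" "y \<in> X 1 2" using that by (simp_all add: root_subgroup_def)
    then show ?thesis by (rule commute_col[OF permutations_of_three(4)])
  qed
  show "?R i = commutator_subgroup G (?R (i - 1)) (?R (i + 1))
      \<or> ?R i = commutator_subgroup G (?R (i + 1)) (?R (i - 1))"
  proof (cases i rule: hexagon_cases)
    case 1
    then have "?R i = X 1 2" "?R (i - 1) = X 3 2" "?R (i + 1) = X 1 3" by (simp_all add: root_subgroup_def)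
    then show ?thesis by (simp only: commutator_X[OF permutations_of_three(2)] simp_thms)
  next
    case 2
    then have "?R i = X 1 3" "?R (i - 1) = X 1 2" "?R (i + 1) = X 2 3" by (simp_all add: root_subgroup_def)
    then show ?thesis by (simp only: commutator_X[OF permutations_of_three(1)] simp_thms)
  next
    case 3
    then have "?R i = X 2 3" "?R (i - 1) = X 1 3" "?R (i + 1) = X 2 1" by (simp_all add: root_subgroup_def)
    then show ?thesis by (simp only: commutator_X[OF permutations_of_three(3)] simp_thms)
  next
    case 4
    then have "?R i = X 2 1" "?R (i - 1) = X 2 3" "?R (i + 1) = X 3 1" by (simp_all add: root_subgroup_def)
    then show ?thesis by (simp only: commutator_X[OF permutations_of_three(4)] simp_thms)
  next
    case 5
    then have "?R i = X 3 1" "?R (i - 1) = X 2 1" "?R (i + 1) = X 3 2" by (simp_all add: root_subgroup_def)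
    then show ?thesis by (simp only: commutator_X[OF permutations_of_three(6)] simp_thms)
  next
    case 6
    then have "?R i = X 3 2" "?R (i - 1) = X 3 1" "?R (i + 1) = X 1 2" by (simp_all add: root_subgroup_def)
    then show ?thesis by (simp only: commutator_X[OF permutations_of_three(5)] simp_thms)
  qed
qed

lemma root_subgroups_A2:
  "(\<Union>i\<in>{0..5}. root_subgroup X i) = \<Union>{X i j | i j. i \<in> {1, 2, 3} \<and> j \<in> {1, 2, 3} \<and> i \<noteq> j}"
proof -
  have "{0..5} = {0, 1, 2, 3, 4, 5::int}" by auto
  moreover have "{X i j | i j. i \<in> {1, 2, 3} \<and> j \<in> {1, 2, 3} \<and> i \<noteq> j}
      = {X 1 2, X 1 3, X 2 3, X 2 1, X 3 1, X 3 2}" (is "?S = _")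
  proof
    have "X i j \<in> ?S" if "i \<in> {1, 2, 3}" "j \<in> {1, 2, 3}" "i \<noteq> j" for i j
      using that by blast
    then show "{X 1 2, X 1 3, X 2 3, X 2 1, X 3 1, X 3 2} \<subseteq> ?S"
      by (intro insert_subsetI empty_subsetI) simp_all
  qed auto
  ultimately show ?thesis
    by (simp add: root_subgroup_values)
qed

lemma kazhdan_constant_ge:
  fixes G :: "('g, 'm) monoid_scheme"
  assumes "\<And>(H :: 'v::chilbert_space set) \<pi> v \<epsilon>. unitary_representation G H \<pi> \<Longrightarrow> no_invariant_vectors G H \<pi>
    \<Longrightarrow> v \<in> H \<Longrightarrow> v \<noteq> 0 \<Longrightarrow> 0 < \<epsilon> \<Longrightarrow> (\<And>s. s \<in> S \<Longrightarrow> norm (\<pi> s v - v) \<le> \<epsilon> * norm v) \<Longrightarrow> c \<le> \<epsilon>"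
  shows "ereal c \<le> kazhdan_constant TYPE('v) G S"
  unfolding kazhdan_constant_def rep_kazhdan_constant_def
  using assms by (auto intro!: INF_greatest Inf_greatest)

theorem theorem5p5:
  fixes G :: "('g, 'm) monoid_scheme"
    and X Gr :: "nat \<Rightarrow> nat \<Rightarrow> 'g set"
  assumes "A2_system G X"
    and "\<And>i j k. {i, j, k} = {1, 2, 3} \<Longrightarrow> Gr i j = generate G (X i k \<union> X k j)"
  shows "kazhdan_constant TYPE('v::chilbert_space) G
           (\<Union>{Gr i j | i j. i \<in> {1, 2, 3} \<and> j \<in> {1, 2, 3} \<and> i \<noteq> j}) \<ge> ereal (3 / 8)
       \<and> kazhdan_constant TYPE('v) G
           (\<Union>{X i j | i j. i \<in> {1, 2, 3} \<and> j \<in> {1, 2, 3} \<and> i \<noteq> j}) \<ge> ereal (1 / 8)"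
proof (intro conjI kazhdan_constant_ge)
  fix H :: "'v set" and \<pi> :: "'g \<Rightarrow> 'v \<Rightarrow> 'v" and v :: 'v and \<epsilon> :: real
  assume rep: "unitary_representation G H \<pi>" and inv: "no_invariant_vectors G H \<pi>"
    and v: "v \<in> H" "v \<noteq> 0" and eps: "0 < \<epsilon>"
  interpret root_hexagon G H \<pi> "root_subgroup X"
    by (rule root_hexagon_A2[OF assms(1) rep])
  have gen: "generate G (\<Union>i\<in>{0..5}. root_subgroup X i) = carrier G"
    unfolding root_subgroups_A2 by (rule A2_system.generate_X[OF assms(1)])
  show "3 / 8 \<le> \<epsilon>"
    if small: "\<And>s. s \<in> \<Union>{Gr i j | i j. i \<in> {1, 2, 3} \<and> j \<in> {1, 2, 3} \<and> i \<noteq> j}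
      \<Longrightarrow> norm (\<pi> s v - v) \<le> \<epsilon> * norm v"
  proof (rule displacement_of_triples[OF gen inv v eps])
    fix i :: int and g
    assume i: "i \<in> {1, 4}" and g: "g \<in> generate G (root_subgroup X (i - 1) \<union> root_subgroup X (i + 1))"
    \<comment> \<open>The positions 1 and 4 of the hexagon are the opposite roots 13 and 31.\<close>
    have "generate G (root_subgroup X 0 \<union> root_subgroup X 2) = Gr 1 3"
      using assms(2)[OF permutations_of_three(2)] by (simp add: root_subgroup_values)
    moreover have "generate G (root_subgroup X 3 \<union> root_subgroup X 5) = Gr 3 1"
      using assms(2)[OF permutations_of_three(5)] by (simp add: root_subgroup_values Un_commute)
    ultimately have "g \<in> Gr 1 3 \<union> Gr 3 1"
      using i g by auto
    moreover have "Gr a b \<subseteq> \<Union>{Gr i j | i j. i \<in> {1, 2, 3} \<and> j \<in> {1, 2, 3} \<and> i \<noteq> j}"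
      if "a \<in> {1, 2, 3}" "b \<in> {1, 2, 3}" "a \<noteq> b" for a b
      using that by (intro Union_upper) blast
    from this[of 1 3] this[of 3 1]
    have "Gr 1 3 \<union> Gr 3 1 \<subseteq> \<Union>{Gr i j | i j. i \<in> {1, 2, 3} \<and> j \<in> {1, 2, 3} \<and> i \<noteq> j}"
      by simp
    ultimately show "norm (\<pi> g v - v) \<le> \<epsilon> * norm v"
      by (intro small) (rule subsetD)
  qed
  show "1 / 8 \<le> \<epsilon>"
    if small: "\<And>s. s \<in> \<Union>{X i j | i j. i \<in> {1, 2, 3} \<and> j \<in> {1, 2, 3} \<and> i \<noteq> j}
      \<Longrightarrow> norm (\<pi> s v - v) \<le> \<epsilon> * norm v"
    using small unfolding root_subgroups_A2[symmetric]
    by (intro displacement_of_roots[OF gen inv v eps]) blast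
qed

end
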